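(* Let $G$ and $H$ be locally compact Hausdorff étale groupoids with paracompact unit spaces, let $Z$ be a $(G,H)$-equivalence, and let $p\in[1,\infty]$. Let $(E^{<},E^{>})$ be the standard Morita equivalence between $F^p_{\mathrm{red}}(G)$ and $F^p_{\mathrm{red}}(H)$ obtained by completing the bimodule $C_c(Z)$ (as described in the context). Then it induces a lattice isomorphism between the dynamical ideals of $F^p_{\mathrm{red}}(G)$ and the dynamical ideals of $F^p_{\mathrm{red}}(H)$. More precisely, $$\operatorname{Ind}_{F^p_{\mathrm{red}}(G)}^{F^p_{\mathrm{red}}(H)}(I_U^G)=I_{\Theta(U)}^H$$ for every open invariant $U\subseteq G^{(0)}$.
   Context: All Banach spaces and algebras are complex; module actions are contractive. For a groupoid $G$, $G^{(0)}$ is the unit space and $r,s$ are the range and source maps. Groupoid equivalences. A left $G$-space is a locally compact Hausdorff space $Z$ with a continuous open anchor map $r_Z:Z\to G^{(0)}$ and a continuous action $\{(\gamma,z):s(\gamma)=r_Z(z)\}\to Z$, $(\gamma,z)\mapsto\gamma\cdot z$, with the usual unit and associativity identities. It is free if $\gamma\cdot z=z$ forces $\gamma=r_Z(z)$, and proper if $(\gamma,z)\mapsto(\gamma\cdot z,z)$ from $G*Z=\{(\gamma,z)\in G\times Z:s(\gamma)=r_Z(z)\}$ to $Z\times Z$ is proper. Right $H$-spaces are analogous, with anchor map $s_Z:Z\to H^{(0)}$ ($z\cdot\eta$ is defined when $s_Z(z)=r(\eta)$). A $(G,H)$-equivalence is a locally compact Hausdorff space $Z$ that is a free and proper left $G$-space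 and a free and proper right $H$-space, such that the actions commute and the anchor maps induce homeomorphisms $Z/H\cong G^{(0)}$ and $G\backslash Z\cong H^{(0)}$. Reduced algebras. $F^p_{\mathrm{red}}(G)$ is the completion of the convolution algebra $C_c(G)$ in the norm $\|f\|=\sup_{x\in G^{(0)}}\|\lambda_x(f)\|$, where $\lambda_x(f)\in B(\ell^p(s^{-1}(x)))$ is $(\lambda_x(f)\xi)(\gamma)=\sum_{r(\eta)=r(\gamma)}f(\eta)\xi(\eta^{-1}\gamma)$. Dynamical ideals. An open $U\subseteq G^{(0)}$ is invariant if $r(\gamma)\in U\Rightarrow s(\gamma)\in U$ for all $\gamma\in G$. Put $G|_U=\{\gamma:r(\gamma),s(\gamma)\in U\}$ and $I_U^G=\overline{C_c(G|_U)}\subseteq F^p_{\mathrm{red}}(G)$ (functions extended by zero), a closed two-sided ideal. A closed ideal of $F^p_{\mathrm{red}}(G)$ is dynamical if it equals $I_U^G$ for some open invariant $U$. Dynamical ideals are ordered by inclusion. Similarly for $H$. For $U\subseteq G^{(0)}$ open invariant, $\Theta(U)=s_Z(r_Z^{-1}(U))\subseteq H^{(0)}$, which is open and invariant. Morita equivalence. $\overline{\operatorname{span}}\,S$ is the closed linear span of $S$. A Morita equivalence $(E^{<},E^{>})$ between Banach algebras $A$ and $B$ consists of a Banach $B$-$A$-bimodule $E^{<}$, a Banach $A$-$B$-bimodule $E^{>}$, and bilinear pairings $\langle\cdot,\cdot\rangle_B:E^{<}\times E^{>}\to B$, ${}_A\langle\cdot,\cdot\rangle:E^{>}\times E^{<}\to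 A$ of norm at most one such that for all $e^{<},f^{<}\in E^{<}$, $e^{>},f^{>}\in E^{>}$, $a\in A$, $b\in B$: $\langle be^{<},e^{>}\rangle_B=b\langle e^{<},e^{>}\rangle_B$, $\langle e^{<},e^{>}b\rangle_B=\langle e^{<},e^{>}\rangle_Bb$, ${}_A\langle ae^{>},e^{<}\rangle=a\,{}_A\langle e^{>},e^{<}\rangle$, ${}_A\langle e^{>},e^{<}a\rangle={}_A\langle e^{>},e^{<}\rangle a$, $\langle e^{<}a,e^{>}\rangle_B=\langle e^{<},ae^{>}\rangle_B$, ${}_A\langle e^{>}b,e^{<}\rangle={}_A\langle e^{>},be^{<}\rangle$, $\langle e^{<},e^{>}\rangle_Bf^{<}=e^{<}\,{}_A\langle e^{>},f^{<}\rangle$, $e^{>}\langle f^{<},f^{>}\rangle_B={}_A\langle e^{>},f^{<}\rangle f^{>}$; the ranges of the pairings span dense subspaces of $B$ and $A$; and all four module actions are nondegenerate (module products span a dense subspace). For a closed two-sided ideal $J$ of $A$, $\operatorname{Ind}_A^B(J)=\overline{\operatorname{span}}\,\{\langle\eta,\xi\rangle_B:\eta\in E_J^{<},\ \xi\in E^{>}\}$ where $E_J^{<}=\{\eta\in E^{<}:{}_A\langle\xi,\eta\rangle\in J\ \forall\xi\in E^{>}\}$; this is a closed two-sided ideal of $B$. The standard Morita equivalence. With $A=F^p_{\mathrm{red}}(G)$ and $B=F^p_{\mathrm{red}}(H)$, the Morita equivalence $(E^{<},E^{>})$ is one in which $E^{>}$ is a completion of $C_c(Z)$ (so $C_c(Z)$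 is a dense subspace of $E^{>}$) and the module actions on $E^{>}$ extend $$(a\cdot\xi)(z)=\sum_{r(\gamma)=r_Z(z)}a(\gamma)\xi(\gamma^{-1}\cdot z),\qquad(\xi\cdot b)(z)=\sum_{r(\eta)=s_Z(z)}\xi(z\cdot\eta)b(\eta^{-1})$$ for $a\in C_c(G)$, $b\in C_c(H)$, $\xi\in C_c(Z)$. (That $C_c(Z)$ completes to such a Morita equivalence when the unit spaces are paracompact is a known theorem of Chung, Delfín and Wang.) *)

theory Defs
  imports "HOL-Analysis.Analysis" "HOL-Algebra.Lattice"
begin

section \<open>Complex Banach spaces and Banach algebras\<close>

class scaleC =
  fixes scaleC :: "complex \<Rightarrow> 'a \<Rightarrow> 'a"  (infixr \<open>*\<^sub>C\<close> 75)

class complex_banach = banach + scaleC +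
  assumes scaleC_add_right: "a *\<^sub>C (x + y) = a *\<^sub>C x + a *\<^sub>C y"
    and scaleC_add_left: "(a + b) *\<^sub>C x = a *\<^sub>C x + b *\<^sub>C x"
    and scaleC_scaleC: "a *\<^sub>C (b *\<^sub>C x) = (a * b) *\<^sub>C x"
    and scaleC_of_real: "complex_of_real t *\<^sub>C x = t *\<^sub>R x"
    and norm_scaleC: "norm (a *\<^sub>C x) = cmod a * norm x"

text \<open>Algebras are not assumed to be unital.\<close>

class complex_banach_algebra = complex_banach + real_normed_algebra +
  assumes mult_scaleC_left: "(a *\<^sub>C x) * y = a *\<^sub>C (x * y)"
    and mult_scaleC_right: "x * (a *\<^sub>C y) = a *\<^sub>C (x * y)"

global_interpretation complex_vector:
  vector_space "scaleC :: complex \<Rightarrow> 'a \<Rightarrow> 'a::complex_banach"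
proof
  fix a b :: complex and x y :: 'a
  show "a *\<^sub>C (x + y) = a *\<^sub>C x + a *\<^sub>C y" by (rule scaleC_add_right)
  show "(a + b) *\<^sub>C x = a *\<^sub>C x + b *\<^sub>C x" by (rule scaleC_add_left)
  show "a *\<^sub>C (b *\<^sub>C x) = (a * b) *\<^sub>C x" by (rule scaleC_scaleC)
  show "1 *\<^sub>C x = x" using scaleC_of_real[of 1 x] by simp
qed

definition closed_span :: "'a::complex_banach set \<Rightarrow> 'a set" where
  "closed_span S = closure (complex_vector.span S)"

definition closed_ideal :: "'a::complex_banach_algebra set \<Rightarrow> bool" where
  "closed_ideal J \<longleftrightarrow> closed J \<and> complex_vector.subspace J \<and>
     (\<forall>a. \<forall>x\<in>J. a * x \<in> J \<and> x * a \<in> J)"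

definition contractive_bilinear ::
  "('a::complex_banach \<Rightarrow> 'b::complex_banach \<Rightarrow> 'c::complex_banach) \<Rightarrow> bool" where
  "contractive_bilinear f \<longleftrightarrow>
     (\<forall>x x' y. f (x + x') y = f x y + f x' y) \<and>
     (\<forall>x y y'. f x (y + y') = f x y + f x y') \<and>
     (\<forall>c x y. f (c *\<^sub>C x) y = c *\<^sub>C f x y) \<and>
     (\<forall>c x y. f x (c *\<^sub>C y) = c *\<^sub>C f x y) \<and>
     (\<forall>x y. norm (f x y) \<le> norm x * norm y)"

definition banach_bimodule ::
  "('a::complex_banach_algebra \<Rightarrow> 'e::complex_banach \<Rightarrow> 'e) \<Rightarrow>
   ('e \<Rightarrow> 'b::complex_banach_algebra \<Rightarrow> 'e) \<Rightarrow> bool" where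
  "banach_bimodule l r \<longleftrightarrow> contractive_bilinear l \<and> contractive_bilinear r \<and>
     (\<forall>a a' e. l (a * a') e = l a (l a' e)) \<and>
     (\<forall>e b b'. r e (b * b') = r (r e b) b') \<and>
     (\<forall>a e b. r (l a e) b = l a (r e b))"

section \<open>Morita equivalences of Banach algebras\<close>

text \<open>
  The type variables stand for $A$, $B$, $E^{<}$, $E^{>}$. The actions on $E^{<}$ (a
  $B$-$A$-bimodule) are \<open>lt_left\<close> and \<open>lt_right\<close>, those on $E^{>}$ (an
  $A$-$B$-bimodule) are \<open>gt_left\<close> and \<open>gt_right\<close>.
\<close>

record ('a, 'b, 'e, 'f) morita_data =
  lt_left :: "'b \<Rightarrow> 'e \<Rightarrow> 'e"
  lt_right :: "'e \<Rightarrow> 'a \<Rightarrow> 'e"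
  gt_left :: "'a \<Rightarrow> 'f \<Rightarrow> 'f"
  gt_right :: "'f \<Rightarrow> 'b \<Rightarrow> 'f"
  pairB :: "'e \<Rightarrow> 'f \<Rightarrow> 'b"
  pairA :: "'f \<Rightarrow> 'e \<Rightarrow> 'a"

locale morita_equivalence =
  fixes M :: "('a::complex_banach_algebra, 'b::complex_banach_algebra,
               'e::complex_banach, 'f::complex_banach) morita_data"
  assumes bimodule_lt: "banach_bimodule (lt_left M) (lt_right M)"
    and bimodule_gt: "banach_bimodule (gt_left M) (gt_right M)"
    and bilinear_pairB: "contractive_bilinear (pairB M)"
    and bilinear_pairA: "contractive_bilinear (pairA M)"
    and pairB_left: "pairB M (lt_left M b e) f = b * pairB M e f"
    and pairB_right: "pairB M e (gt_right M f b) = pairB M e f * b"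
    and pairA_left: "pairA M (gt_left M a f) e = a * pairA M f e"
    and pairA_right: "pairA M f (lt_right M e a) = pairA M f e * a"
    and pairB_balanced: "pairB M (lt_right M e a) f = pairB M e (gt_left M a f)"
    and pairA_balanced: "pairA M (gt_right M f b) e = pairA M f (lt_left M b e)"
    and linking_lt: "lt_left M (pairB M e f) e' = lt_right M e (pairA M f e')"
    and linking_gt: "gt_right M f (pairB M e f') = gt_left M (pairA M f e) f'"
    and pairB_full: "closed_span {pairB M e f | e f. True} = UNIV"
    and pairA_full: "closed_span {pairA M f e | f e. True} = UNIV"
    and nondeg_lt_left: "closed_span {lt_left M b e | b e. True} = UNIV"
    and nondeg_lt_right: "closed_span {lt_right M e a | e a. True} = UNIV"
    and nondeg_gt_left: "closed_span {gt_left M a f | a f. True} = UNIV"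
    and nondeg_gt_right: "closed_span {gt_right M f b | f b. True} = UNIV"

definition Ind ::
  "('a::complex_banach_algebra, 'b::complex_banach_algebra,
    'e::complex_banach, 'f::complex_banach) morita_data \<Rightarrow> 'a set \<Rightarrow> 'b set" where
  "Ind M J = closed_span {pairB M \<eta> \<xi> | \<eta> \<xi>. \<forall>\<zeta>. pairA M \<zeta> \<eta> \<in> J}"

section \<open>Topological preliminaries\<close>

definition paracompact_space :: "'x topology \<Rightarrow> bool" where
  "paracompact_space X \<longleftrightarrow>
     (\<forall>\<U>. (\<forall>U\<in>\<U>. openin X U) \<and> \<Union>\<U> = topspace X \<longrightarrow>
        (\<exists>\<V>. (\<forall>V\<in>\<V>. openin X V) \<and> \<Union>\<V> = topspace X \<and>
             (\<forall>V\<in>\<V>. \<exists>U\<in>\<U>. V \<subseteq> U) \<and> locally_finite_in X \<V>))"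

definition local_homeomorphism :: "'x topology \<Rightarrow> 'y topology \<Rightarrow> ('x \<Rightarrow> 'y) \<Rightarrow> bool" where
  "local_homeomorphism X Y f \<longleftrightarrow>
     (\<forall>x\<in>topspace X. \<exists>U V. openin X U \<and> x \<in> U \<and> openin Y V \<and>
        homeomorphic_map (subtopology X U) (subtopology Y V) f)"

definition quotient_topology :: "'x topology \<Rightarrow> ('x \<Rightarrow> 'q) \<Rightarrow> 'q topology" where
  "quotient_topology X q =
     topology (\<lambda>W. W \<subseteq> q ` topspace X \<and> openin X {x \<in> topspace X. q x \<in> W})"

lemma openin_quotient_topology:
  "openin (quotient_topology X q) W \<longleftrightarrow>
     W \<subseteq> q ` topspace X \<and> openin X {x \<in> topspace X. q x \<in> W}"
proof -
  have "istopology (\<lambda>W. W \<subseteq> q ` topspace X \<and> openin X {x \<in> topspace X. q x \<in> W})"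
    unfolding istopology_def
  proof (intro conjI allI impI)
    fix S T
    assume S: "S \<subseteq> q ` topspace X \<and> openin X {x \<in> topspace X. q x \<in> S}"
      and T: "T \<subseteq> q ` topspace X \<and> openin X {x \<in> topspace X. q x \<in> T}"
    show "S \<inter> T \<subseteq> q ` topspace X" using S by blast
    have "{x \<in> topspace X. q x \<in> S \<inter> T} =
        {x \<in> topspace X. q x \<in> S} \<inter> {x \<in> topspace X. q x \<in> T}" by blast
    then show "openin X {x \<in> topspace X. q x \<in> S \<inter> T}" using S T by auto
  next
    fix K
    assume K: "\<forall>S\<in>K. S \<subseteq> q ` topspace X \<and> openin X {x \<in> topspace X. q x \<in> S}"
    show "\<Union>K \<subseteq> q ` topspace X" using K by blast
    have "{x \<in> topspace X. q x \<in> \<Union>K} = (\<Union>S\<in>K. {x \<in> topspace X. q x \<in> S})" by blast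
    then show "openin X {x \<in> topspace X. q x \<in> \<Union>K}" using K by auto
  qed
  then show ?thesis by (simp add: quotient_topology_def)
qed

text \<open>
  Functions on a space \<open>X\<close> are represented by total functions vanishing outside
  \<open>topspace X\<close>. Hence, for \<open>S\<close> open in \<open>X\<close>, the set \<open>Cc (subtopology X S)\<close> consists of
  the elements of $C_c(S)$ extended by zero to \<open>X\<close>.
\<close>

definition Cc :: "'x topology \<Rightarrow> ('x \<Rightarrow> complex) set" where
  "Cc X = {f. continuous_map X euclidean f \<and> (\<forall>x. x \<notin> topspace X \<longrightarrow> f x = 0) \<and>
              compactin X (X closure_of {x \<in> topspace X. f x \<noteq> 0})}"

text \<open>\<open>j\<close> is a complex linear map on the space \<open>Cc X\<close>; its values elsewhere are irrelevant.\<close>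

definition linear_on_Cc :: "'x topology \<Rightarrow> (('x \<Rightarrow> complex) \<Rightarrow> 'e::complex_banach) \<Rightarrow> bool" where
  "linear_on_Cc X j \<longleftrightarrow>
     (\<forall>f\<in>Cc X. \<forall>g\<in>Cc X. j (\<lambda>x. f x + g x) = j f + j g) \<and>
     (\<forall>c. \<forall>f\<in>Cc X. j (\<lambda>x. c * f x) = c *\<^sub>C j f)"

section \<open>Etale groupoids\<close>

text \<open>
  The topological space \<open>gtop G\<close> carries the set of arrows. Units are identified with their
  identity arrows, so that the range and source maps take values in the arrows. The product
  \<open>gmult G \<gamma> \<eta>\<close> is only meaningful if \<open>gsrc G \<gamma> = grng G \<eta>\<close>.
\<close>

record 'g groupoid_data =
  gtop :: "'g topology"
  gmult :: "'g \<Rightarrow> 'g \<Rightarrow> 'g"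
  ginv :: "'g \<Rightarrow> 'g"
  grng :: "'g \<Rightarrow> 'g"
  gsrc :: "'g \<Rightarrow> 'g"

definition arrows :: "'g groupoid_data \<Rightarrow> 'g set" where
  "arrows G = topspace (gtop G)"

definition units :: "'g groupoid_data \<Rightarrow> 'g set" where
  "units G = gsrc G ` arrows G"

definition unit_space :: "'g groupoid_data \<Rightarrow> 'g topology" where
  "unit_space G = subtopology (gtop G) (units G)"

locale groupoid =
  fixes G :: "'g groupoid_data"
  assumes src_arrow: "\<gamma> \<in> arrows G \<Longrightarrow> gsrc G \<gamma> \<in> arrows G"
    and rng_arrow: "\<gamma> \<in> arrows G \<Longrightarrow> grng G \<gamma> \<in> arrows G"
    and src_src: "\<gamma> \<in> arrows G \<Longrightarrow> gsrc G (gsrc G \<gamma>) = gsrc G \<gamma>"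
    and rng_src: "\<gamma> \<in> arrows G \<Longrightarrow> grng G (gsrc G \<gamma>) = gsrc G \<gamma>"
    and src_rng: "\<gamma> \<in> arrows G \<Longrightarrow> gsrc G (grng G \<gamma>) = grng G \<gamma>"
    and rng_rng: "\<gamma> \<in> arrows G \<Longrightarrow> grng G (grng G \<gamma>) = grng G \<gamma>"
    and mult_arrow: "\<lbrakk>\<gamma> \<in> arrows G; \<eta> \<in> arrows G; gsrc G \<gamma> = grng G \<eta>\<rbrakk>
          \<Longrightarrow> gmult G \<gamma> \<eta> \<in> arrows G"
    and src_mult: "\<lbrakk>\<gamma> \<in> arrows G; \<eta> \<in> arrows G; gsrc G \<gamma> = grng G \<eta>\<rbrakk>
          \<Longrightarrow> gsrc G (gmult G \<gamma> \<eta>) = gsrc G \<eta>"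
    and rng_mult: "\<lbrakk>\<gamma> \<in> arrows G; \<eta> \<in> arrows G; gsrc G \<gamma> = grng G \<eta>\<rbrakk>
          \<Longrightarrow> grng G (gmult G \<gamma> \<eta>) = grng G \<gamma>"
    and mult_assoc: "\<lbrakk>\<gamma> \<in> arrows G; \<eta> \<in> arrows G; \<theta> \<in> arrows G;
             gsrc G \<gamma> = grng G \<eta>; gsrc G \<eta> = grng G \<theta>\<rbrakk>
          \<Longrightarrow> gmult G (gmult G \<gamma> \<eta>) \<theta> = gmult G \<gamma> (gmult G \<eta> \<theta>)"
    and rng_unit: "\<gamma> \<in> arrows G \<Longrightarrow> gmult G (grng G \<gamma>) \<gamma> = \<gamma>"
    and src_unit: "\<gamma> \<in> arrows G \<Longrightarrow> gmult G \<gamma> (gsrc G \<gamma>) = \<gamma>"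
    and inv_arrow: "\<gamma> \<in> arrows G \<Longrightarrow> ginv G \<gamma> \<in> arrows G"
    and src_inv: "\<gamma> \<in> arrows G \<Longrightarrow> gsrc G (ginv G \<gamma>) = grng G \<gamma>"
    and rng_inv: "\<gamma> \<in> arrows G \<Longrightarrow> grng G (ginv G \<gamma>) = gsrc G \<gamma>"
    and inv_left: "\<gamma> \<in> arrows G \<Longrightarrow> gmult G (ginv G \<gamma>) \<gamma> = gsrc G \<gamma>"
    and inv_right: "\<gamma> \<in> arrows G \<Longrightarrow> gmult G \<gamma> (ginv G \<gamma>) = grng G \<gamma>"

text \<open>Local compactness and the Hausdorff property are part of \<open>etale_groupoid\<close>.\<close>

locale etale_groupoid = groupoid +
  assumes Hausdorff: "Hausdorff_space (gtop G)"
    and locally_compact: "locally_compact_space (gtop G)"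
    and continuous_mult: "continuous_map
          (subtopology (prod_topology (gtop G) (gtop G)) {(\<gamma>, \<eta>). gsrc G \<gamma> = grng G \<eta>})
          (gtop G) (\<lambda>(\<gamma>, \<eta>). gmult G \<gamma> \<eta>)"
    and continuous_inv: "continuous_map (gtop G) (gtop G) (ginv G)"
    and etale_src: "local_homeomorphism (gtop G) (unit_space G) (gsrc G)"
    and etale_rng: "local_homeomorphism (gtop G) (unit_space G) (grng G)"

definition open_invariant :: "'g groupoid_data \<Rightarrow> 'g set \<Rightarrow> bool" where
  "open_invariant G U \<longleftrightarrow> openin (unit_space G) U \<and>
     (\<forall>\<gamma>\<in>arrows G. grng G \<gamma> \<in> U \<longrightarrow> gsrc G \<gamma> \<in> U)"

definition restriction :: "'g groupoid_data \<Rightarrow> 'g set \<Rightarrow> 'g set" where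
  "restriction G U = {\<gamma> \<in> arrows G. grng G \<gamma> \<in> U \<and> gsrc G \<gamma> \<in> U}"

section \<open>Groupoid equivalences\<close>

record ('g, 'h, 'z) bispace =
  ztop :: "'z topology"
  anchor_l :: "'z \<Rightarrow> 'g"
  anchor_r :: "'z \<Rightarrow> 'h"
  act_l :: "'g \<Rightarrow> 'z \<Rightarrow> 'z"
  act_r :: "'z \<Rightarrow> 'h \<Rightarrow> 'z"

locale left_space =
  fixes G :: "'g groupoid_data" and Z :: "'z topology"
    and anchor :: "'z \<Rightarrow> 'g" and act :: "'g \<Rightarrow> 'z \<Rightarrow> 'z"
  assumes Hausdorff: "Hausdorff_space Z"
    and locally_compact: "locally_compact_space Z"
    and continuous_anchor: "continuous_map Z (unit_space G) anchor"
    and open_anchor: "open_map Z (unit_space G) anchor"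
    and continuous_act: "continuous_map
          (subtopology (prod_topology (gtop G) Z) {(\<gamma>, z). gsrc G \<gamma> = anchor z})
          Z (\<lambda>(\<gamma>, z). act \<gamma> z)"
    and anchor_act: "\<lbrakk>\<gamma> \<in> arrows G; z \<in> topspace Z; gsrc G \<gamma> = anchor z\<rbrakk>
          \<Longrightarrow> anchor (act \<gamma> z) = grng G \<gamma>"
    and act_unit: "z \<in> topspace Z \<Longrightarrow> act (anchor z) z = z"
    and act_mult: "\<lbrakk>\<gamma> \<in> arrows G; \<eta> \<in> arrows G; z \<in> topspace Z;
             gsrc G \<gamma> = grng G \<eta>; gsrc G \<eta> = anchor z\<rbrakk>
          \<Longrightarrow> act (gmult G \<gamma> \<eta>) z = act \<gamma> (act \<eta> z)"

locale free_proper_left_space = left_space +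
  assumes free: "\<lbrakk>\<gamma> \<in> arrows G; z \<in> topspace Z; gsrc G \<gamma> = anchor z; act \<gamma> z = z\<rbrakk>
          \<Longrightarrow> \<gamma> = anchor z"
    and proper: "proper_map
          (subtopology (prod_topology (gtop G) Z) {(\<gamma>, z). gsrc G \<gamma> = anchor z})
          (prod_topology Z Z) (\<lambda>(\<gamma>, z). (act \<gamma> z, z))"

locale right_space =
  fixes H :: "'h groupoid_data" and Z :: "'z topology"
    and anchor :: "'z \<Rightarrow> 'h" and act :: "'z \<Rightarrow> 'h \<Rightarrow> 'z"
  assumes Hausdorff: "Hausdorff_space Z"
    and locally_compact: "locally_compact_space Z"
    and continuous_anchor: "continuous_map Z (unit_space H) anchor"
    and open_anchor: "open_map Z (unit_space H) anchor"
    and continuous_act: "continuous_map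
          (subtopology (prod_topology Z (gtop H)) {(z, \<eta>). anchor z = grng H \<eta>})
          Z (\<lambda>(z, \<eta>). act z \<eta>)"
    and anchor_act: "\<lbrakk>z \<in> topspace Z; \<eta> \<in> arrows H; anchor z = grng H \<eta>\<rbrakk>
          \<Longrightarrow> anchor (act z \<eta>) = gsrc H \<eta>"
    and act_unit: "z \<in> topspace Z \<Longrightarrow> act z (anchor z) = z"
    and act_mult: "\<lbrakk>z \<in> topspace Z; \<eta> \<in> arrows H; \<theta> \<in> arrows H;
             anchor z = grng H \<eta>; gsrc H \<eta> = grng H \<theta>\<rbrakk>
          \<Longrightarrow> act z (gmult H \<eta> \<theta>) = act (act z \<eta>) \<theta>"

locale free_proper_right_space = right_space +
  assumes free: "\<lbrakk>z \<in> topspace Z; \<eta> \<in> arrows H; anchor z = grng H \<eta>; act z \<eta> = z\<rbrakk>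
          \<Longrightarrow> \<eta> = anchor z"
    and proper: "proper_map
          (subtopology (prod_topology Z (gtop H)) {(z, \<eta>). anchor z = grng H \<eta>})
          (prod_topology Z Z) (\<lambda>(z, \<eta>). (z, act z \<eta>))"

definition orbit_l :: "'g groupoid_data \<Rightarrow> ('g, 'h, 'z) bispace \<Rightarrow> 'z \<Rightarrow> 'z set" where
  "orbit_l G Z z = {act_l Z \<gamma> z | \<gamma>. \<gamma> \<in> arrows G \<and> gsrc G \<gamma> = anchor_l Z z}"

definition orbit_r :: "'h groupoid_data \<Rightarrow> ('g, 'h, 'z) bispace \<Rightarrow> 'z \<Rightarrow> 'z set" where
  "orbit_r H Z z = {act_r Z z \<eta> | \<eta>. \<eta> \<in> arrows H \<and> anchor_r Z z = grng H \<eta>}"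

locale groupoid_equivalence =
  fixes G :: "'g groupoid_data" and H :: "'h groupoid_data"
    and Z :: "('g, 'h, 'z) bispace"
  assumes left: "free_proper_left_space G (ztop Z) (anchor_l Z) (act_l Z)"
    and right: "free_proper_right_space H (ztop Z) (anchor_r Z) (act_r Z)"
    and anchor_r_act_l: "\<lbrakk>\<gamma> \<in> arrows G; z \<in> topspace (ztop Z); gsrc G \<gamma> = anchor_l Z z\<rbrakk>
          \<Longrightarrow> anchor_r Z (act_l Z \<gamma> z) = anchor_r Z z"
    and anchor_l_act_r: "\<lbrakk>z \<in> topspace (ztop Z); \<eta> \<in> arrows H; anchor_r Z z = grng H \<eta>\<rbrakk>
          \<Longrightarrow> anchor_l Z (act_r Z z \<eta>) = anchor_l Z z"
    and act_commute: "\<lbrakk>\<gamma> \<in> arrows G; z \<in> topspace (ztop Z); \<eta> \<in> arrows H;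
             gsrc G \<gamma> = anchor_l Z z; anchor_r Z z = grng H \<eta>\<rbrakk>
          \<Longrightarrow> act_r Z (act_l Z \<gamma> z) \<eta> = act_l Z \<gamma> (act_r Z z \<eta>)"
    and anchor_l_induces_homeomorphism:
      "\<exists>h. homeomorphic_map (quotient_topology (ztop Z) (orbit_r H Z)) (unit_space G) h \<and>
           (\<forall>z\<in>topspace (ztop Z). h (orbit_r H Z z) = anchor_l Z z)"
    and anchor_r_induces_homeomorphism:
      "\<exists>h. homeomorphic_map (quotient_topology (ztop Z) (orbit_l G Z)) (unit_space H) h \<and>
           (\<forall>z\<in>topspace (ztop Z). h (orbit_l G Z z) = anchor_r Z z)"

definition Theta :: "('g, 'h, 'z) bispace \<Rightarrow> 'g set \<Rightarrow> 'h set" where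
  "Theta Z U = anchor_r Z ` {z \<in> topspace (ztop Z). anchor_l Z z \<in> U}"

section \<open>Reduced groupoid algebras\<close>

text \<open>The $\ell^p$-norm over the index set \<open>S\<close>; it is \<open>\<infinity>\<close> on functions outside $\ell^p(S)$.\<close>

definition lp_norm :: "ennreal \<Rightarrow> 'i set \<Rightarrow> ('i \<Rightarrow> complex) \<Rightarrow> ennreal" where
  "lp_norm p S \<xi> =
     (if p = \<infinity> then (SUP i\<in>S. ennreal (cmod (\<xi> i)))
      else if (\<lambda>i. cmod (\<xi> i) powr enn2real p) summable_on S
      then ennreal ((\<Sum>\<^sub>\<infinity>i\<in>S. cmod (\<xi> i) powr enn2real p) powr (1 / enn2real p))
      else \<infinity>)"

text \<open>
  The sums below have finitely many nonzero terms for \<open>f \<in> Cc (gtop G)\<close> and \<open>G\<close> etale,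
  because the fibres of the range map are then closed and discrete. \<open>regular_rep G x f\<close> is
  the operator $\lambda_x(f)$ on functions on $s^{-1}(x)$.
\<close>

definition convolution ::
  "'g groupoid_data \<Rightarrow> ('g \<Rightarrow> complex) \<Rightarrow> ('g \<Rightarrow> complex) \<Rightarrow> 'g \<Rightarrow> complex" where
  "convolution G f g = (\<lambda>\<gamma>. if \<gamma> \<in> arrows G
     then \<Sum>\<^sub>\<infinity>\<eta>\<in>{\<eta> \<in> arrows G. grng G \<eta> = grng G \<gamma>}. f \<eta> * g (gmult G (ginv G \<eta>) \<gamma>)
     else 0)"

definition src_fibre :: "'g groupoid_data \<Rightarrow> 'g \<Rightarrow> 'g set" where
  "src_fibre G x = {\<gamma> \<in> arrows G. gsrc G \<gamma> = x}"

definition regular_rep ::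
  "'g groupoid_data \<Rightarrow> 'g \<Rightarrow> ('g \<Rightarrow> complex) \<Rightarrow> ('g \<Rightarrow> complex) \<Rightarrow> 'g \<Rightarrow> complex" where
  "regular_rep G x f \<xi> = (\<lambda>\<gamma>. if \<gamma> \<in> src_fibre G x
     then \<Sum>\<^sub>\<infinity>\<eta>\<in>{\<eta> \<in> arrows G. grng G \<eta> = grng G \<gamma>}. f \<eta> * \<xi> (gmult G (ginv G \<eta>) \<gamma>)
     else 0)"

definition reduced_norm :: "ennreal \<Rightarrow> 'g groupoid_data \<Rightarrow> ('g \<Rightarrow> complex) \<Rightarrow> ennreal" where
  "reduced_norm p G f =
     (SUP x\<in>units G. SUP \<xi>\<in>{\<xi>. lp_norm p (src_fibre G x) \<xi> \<le> 1}.
        lp_norm p (src_fibre G x) (regular_rep G x f \<xi>))"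

text \<open>
  \<open>is_Fp_red p G \<iota>\<close>: the Banach algebra \<open>'a\<close>, together with the canonical map \<open>\<iota>\<close> of
  $C_c(G)$ into it, is the completion $F^p_{\mathrm{red}}(G)$. It is determined by this up to
  a unique isometric isomorphism compatible with the canonical maps.
\<close>

definition is_Fp_red ::
  "ennreal \<Rightarrow> 'g groupoid_data \<Rightarrow> (('g \<Rightarrow> complex) \<Rightarrow> 'a::complex_banach_algebra) \<Rightarrow> bool" where
  "is_Fp_red p G \<iota> \<longleftrightarrow>
     linear_on_Cc (gtop G) \<iota> \<and>
     (\<forall>f\<in>Cc (gtop G). \<forall>g\<in>Cc (gtop G). \<iota> (convolution G f g) = \<iota> f * \<iota> g) \<and>
     (\<forall>f\<in>Cc (gtop G). ennreal (norm (\<iota> f)) = reduced_norm p G f) \<and>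
     closure (\<iota> ` Cc (gtop G)) = UNIV"

definition dyn_ideal ::
  "'g groupoid_data \<Rightarrow> (('g \<Rightarrow> complex) \<Rightarrow> 'a::complex_banach_algebra) \<Rightarrow> 'g set \<Rightarrow> 'a set" where
  "dyn_ideal G \<iota> U = closure (\<iota> ` Cc (subtopology (gtop G) (restriction G U)))"

definition dynamical_ideals ::
  "'g groupoid_data \<Rightarrow> (('g \<Rightarrow> complex) \<Rightarrow> 'a::complex_banach_algebra) \<Rightarrow> 'a set set" where
  "dynamical_ideals G \<iota> =
     {J. closed_ideal J \<and> (\<exists>U. open_invariant G U \<and> J = dyn_ideal G \<iota> U)}"

section \<open>The standard Morita equivalence\<close>

definition Cc_left_action :: "'g groupoid_data \<Rightarrow> ('g, 'h, 'z) bispace \<Rightarrow>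
    ('g \<Rightarrow> complex) \<Rightarrow> ('z \<Rightarrow> complex) \<Rightarrow> 'z \<Rightarrow> complex" where
  "Cc_left_action G Z a \<xi> = (\<lambda>z. if z \<in> topspace (ztop Z)
     then \<Sum>\<^sub>\<infinity>\<gamma>\<in>{\<gamma> \<in> arrows G. grng G \<gamma> = anchor_l Z z}. a \<gamma> * \<xi> (act_l Z (ginv G \<gamma>) z)
     else 0)"

definition Cc_right_action :: "'h groupoid_data \<Rightarrow> ('g, 'h, 'z) bispace \<Rightarrow>
    ('z \<Rightarrow> complex) \<Rightarrow> ('h \<Rightarrow> complex) \<Rightarrow> 'z \<Rightarrow> complex" where
  "Cc_right_action H Z \<xi> b = (\<lambda>z. if z \<in> topspace (ztop Z)
     then \<Sum>\<^sub>\<infinity>\<eta>\<in>{\<eta> \<in> arrows H. grng H \<eta> = anchor_r Z z}. \<xi> (act_r Z z \<eta>) * b (ginv H \<eta>)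
     else 0)"

text \<open>
  \<open>j\<close> is the inclusion of $C_c(Z)$ as a dense subspace of $E^{>}$; \<open>\<iota>G\<close> and \<open>\<iota>H\<close> are the
  canonical maps of $C_c(G)$ and $C_c(H)$ into the reduced algebras.
\<close>

definition standard_morita ::
  "'g groupoid_data \<Rightarrow> 'h groupoid_data \<Rightarrow> ('g, 'h, 'z) bispace \<Rightarrow>
   (('g \<Rightarrow> complex) \<Rightarrow> 'a::complex_banach_algebra) \<Rightarrow>
   (('h \<Rightarrow> complex) \<Rightarrow> 'b::complex_banach_algebra) \<Rightarrow>
   (('z \<Rightarrow> complex) \<Rightarrow> 'f::complex_banach) \<Rightarrow>
   ('a, 'b, 'e::complex_banach, 'f) morita_data \<Rightarrow> bool" where
  "standard_morita G H Z \<iota>G \<iota>H j M \<longleftrightarrow>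
     morita_equivalence M \<and>
     linear_on_Cc (ztop Z) j \<and> inj_on j (Cc (ztop Z)) \<and> closure (j ` Cc (ztop Z)) = UNIV \<and>
     (\<forall>a\<in>Cc (gtop G). \<forall>\<xi>\<in>Cc (ztop Z).
        gt_left M (\<iota>G a) (j \<xi>) = j (Cc_left_action G Z a \<xi>)) \<and>
     (\<forall>\<xi>\<in>Cc (ztop Z). \<forall>b\<in>Cc (gtop H).
        gt_right M (j \<xi>) (\<iota>H b) = j (Cc_right_action H Z \<xi> b))"

section \<open>Lattices of ideals\<close>

definition inclusion_order :: "'x set set \<Rightarrow> 'x set gorder" where
  "inclusion_order D = \<lparr>carrier = D, eq = (=), le = (\<subseteq>)\<rparr>"

text \<open>\<open>join_pres\<close> and \<open>meet_pres\<close> include the requirement that both orders are lattices.\<close>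

definition lattice_isomorphism :: "'x gorder \<Rightarrow> 'y gorder \<Rightarrow> ('x \<Rightarrow> 'y) \<Rightarrow> bool" where
  "lattice_isomorphism L L' f \<longleftrightarrow>
     bij_betw f (carrier L) (carrier L') \<and> join_pres L L' f \<and> meet_pres L L' f"

end

theory Submission
  imports Defs
begin

text \<open>
  If \<open>J\<close> is a closed ideal of \<open>A\<close> and \<open>K\<close> a closed ideal of \<open>B\<close> such that \<open>J E\<^sup>>\<close> and \<open>E\<^sup>> K\<close> have the
  same closed span, and every \<open>b\<close> in \<open>B\<close> lies in the closure of \<open>B b\<close>, then the Morita identities
  alone give \<open>Ind J = K\<close>; nothing has to be known about \<open>E\<^sup><\<close>. For \<open>J = I\<^sub>U\<close> and \<open>K = I\<^bsub>\<Theta>(U)\<^esub>\<close> both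
  closed spans are the closure of \<open>C\<^sub>c(r\<^sub>Z\<inverse>(U))\<close>, because \<open>r\<^sub>Z\<inverse>(U) = s\<^sub>Z\<inverse>(\<Theta>(U))\<close> and bump functions on
  the open unit space act as local units of norm at most one. Since \<open>|f(x)| \<le> \<parallel>f\<parallel>\<close> at units, \<open>U\<close> can be
  recovered from \<open>I\<^sub>U\<close>, so both lattices of dynamical ideals are copies of the lattices of open
  invariant sets, which \<open>\<Theta>\<close> identifies.
\<close>

section \<open>Banach bimodules and induced ideals\<close>

text \<open>Two obstacles shape the argument. A closed ideal of a non-unital Banach algebra need not
  be the closure of its products with the algebra, while the pairing identities give access only to
  such products. The condition that \<open>b\<close> lies in the closure of \<open>B b\<close>
  repairs this; it holds because each f in C_c(H) is reproduced exactly, and not only approximately,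
  by a function on the unit space. The second obstacle is topological: convolutions are sums over
  range fibres, whose index sets vary with the point, so the continuity of a product has to come
  from local sections of the range map. The equality of the preimages of U and \<Theta>(U) rests on
  the orbit space homeomorphisms: two points with the same right anchor lie in one G-orbit, and an
  invariant set contains the left anchors of all points of an orbit or of none. Joins and meets are
  taken inside the ordered set of dynamical ideals, so no sum or intersection of ideals is ever
  computed.\<close>

lemma scaleR_eq_scaleC: "t *\<^sub>R (x::'a::complex_banach) = complex_of_real t *\<^sub>C x"
  by (simp add: scaleC_of_real)

lemma continuous_scaleC: "continuous_on UNIV (\<lambda>x::'a::complex_banach. c *\<^sub>C x)"
proof (rule linear_continuous_on, rule bounded_linear_intro[where K = "cmod c"])
  fix x y :: 'a and t :: real
  show "c *\<^sub>C (x + y) = c *\<^sub>C x + c *\<^sub>C y"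
    by (rule scaleC_add_right)
  show "c *\<^sub>C (t *\<^sub>R x) = t *\<^sub>R (c *\<^sub>C x)"
    by (simp add: scaleR_eq_scaleC scaleC_scaleC mult.commute)
  show "norm (c *\<^sub>C x) \<le> norm x * cmod c"
    by (simp add: norm_scaleC mult.commute)
qed

lemma subspace_closure:
  fixes S :: "'a::complex_banach set"
  assumes "complex_vector.subspace S"
  shows "complex_vector.subspace (closure S)"
proof (rule complex_vector.subspaceI)
  show "0 \<in> closure S"
    using assms closure_subset complex_vector.subspace_0 by blast
next
  fix x y assume "x \<in> closure S" "y \<in> closure S"
  then obtain f g where fg: "\<forall>n. f n \<in> S" "f \<longlonglongrightarrow> x" "\<forall>n. g n \<in> S" "g \<longlonglongrightarrow> y"
    by (auto simp: closure_sequential)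
  then have "(\<lambda>n. f n + g n) \<longlonglongrightarrow> x + y" "\<forall>n. f n + g n \<in> S"
    using assms by (auto intro: tendsto_add complex_vector.subspace_add)
  then show "x + y \<in> closure S"
    by (auto simp: closure_sequential intro!: exI[where x="\<lambda>n. f n + g n"])
next
  fix c :: complex and x assume "x \<in> closure S"
  moreover have "(\<lambda>x. c *\<^sub>C x) ` closure S \<subseteq> closure S"
    by (intro image_closure_subset continuous_on_subset[OF continuous_scaleC])
       (use complex_vector.subspace_scale[OF assms] closure_subset[of S] in auto)
  ultimately show "c *\<^sub>C x \<in> closure S" by blast
qed

lemma subspace_closed_span: "complex_vector.subspace (closed_span S)"
  unfolding closed_span_def by (intro subspace_closure complex_vector.subspace_span)

lemma closed_closed_span: "closed (closed_span S)"
  by (simp add: closed_span_def)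

lemma closed_span_base: "x \<in> S \<Longrightarrow> x \<in> closed_span S"
  unfolding closed_span_def using complex_vector.span_superset closure_subset by blast

lemma closed_span_least:
  assumes "S \<subseteq> L" "closed L" "complex_vector.subspace L"
  shows "closed_span S \<subseteq> L"
  unfolding closed_span_def using assms by (intro closure_minimal complex_vector.span_minimal)

text \<open>The preimage of \<open>L\<close> under a bounded complex linear map is a closed
  subspace, so membership has to be checked on generators only.\<close>

lemma closed_span_mapsto:
  fixes T :: "'a::complex_banach \<Rightarrow> 'b::complex_banach"
  assumes add: "\<And>x y. T (x + y) = T x + T y" and scale: "\<And>c x. T (c *\<^sub>C x) = c *\<^sub>C T x"
    and bound: "\<And>x. norm (T x) \<le> norm x * C"
    and L: "closed L" "complex_vector.subspace L"
    and S: "\<And>x. x \<in> S \<Longrightarrow> T x \<in> L" and x: "x \<in> closed_span S"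
  shows "T x \<in> L"
proof -
  have "bounded_linear T"
    by (rule bounded_linear_intro[where K=C]) (auto simp: add scale bound scaleR_eq_scaleC)
  then have "continuous_on UNIV T"
    by (rule linear_continuous_on)
  then have "closed (T -` L)"
    using L(1) by (simp add: continuous_closed_vimage continuous_on_eq_continuous_at)
  moreover have "complex_vector.subspace (T -` L)"
  proof (rule complex_vector.subspaceI)
    have "T 0 = 0" using add[of 0 0] by simp
    then show "0 \<in> T -` L" using L(2) complex_vector.subspace_0 by auto
  qed (auto simp: add scale intro: L(2) complex_vector.subspace_add complex_vector.subspace_scale)
  ultimately have "closed_span S \<subseteq> T -` L"
    using S by (intro closed_span_least) auto
  then show ?thesis using x by blast
qed

section \<open>Contractive bilinear maps and induction of ideals\<close>

lemma contractive_bilinearD: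
  assumes "contractive_bilinear f"
  shows "f (x + x') y = f x y + f x' y" "f x (y + y') = f x y + f x y'"
    "f (c *\<^sub>C x) y = c *\<^sub>C f x y" "f x (c *\<^sub>C y) = c *\<^sub>C f x y" "norm (f x y) \<le> norm x * norm y"
  using assms unfolding contractive_bilinear_def by blast+

lemma contractive_bilinear_mult: "contractive_bilinear ((*) :: 'a::complex_banach_algebra \<Rightarrow> _)"
  unfolding contractive_bilinear_def
  by (simp add: distrib_left distrib_right mult_scaleC_left mult_scaleC_right norm_mult_ineq)

lemma closed_span_mapsto_right:
  assumes "contractive_bilinear f" "closed L" "complex_vector.subspace L"
    and "\<And>y. y \<in> S \<Longrightarrow> f x y \<in> L" "y \<in> closed_span S"
  shows "f x y \<in> L"
  by (rule closed_span_mapsto[where T="f x" and C="norm x" and S=S])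
     (use assms in \<open>auto simp: contractive_bilinearD mult.commute
        intro: order_trans[OF contractive_bilinearD(5)]\<close>)

lemma closed_span_mapsto_left:
  assumes "contractive_bilinear f" "closed L" "complex_vector.subspace L"
    and "\<And>x. x \<in> S \<Longrightarrow> f x y \<in> L" "x \<in> closed_span S"
  shows "f x y \<in> L"
  by (rule closed_span_mapsto[where T="\<lambda>x. f x y" and C="norm y" and S=S])
     (use assms in \<open>auto simp: contractive_bilinearD\<close>)

text \<open>Both arguments are approximated at once, by joint continuity. It is meant for closures
  of images of C_c-spaces, where no linear span has to be taken.\<close>

lemma bilinear_closure_mapsto:
  assumes f: "contractive_bilinear f" and L: "closed L"
    and "\<And>x y. x \<in> S \<Longrightarrow> y \<in> T \<Longrightarrow> f x y \<in> L" and x: "x \<in> closure S" and y: "y \<in> closure T"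
  shows "f x y \<in> L"
proof -
  have bl: "bounded_bilinear f"
    by (rule bounded_bilinear.intro)
       (auto simp: contractive_bilinearD[OF f] scaleR_eq_scaleC intro!: exI[where x=1])
  obtain u v where uv: "\<And>n. u n \<in> S" "u \<longlonglongrightarrow> x" "\<And>n. v n \<in> T" "v \<longlonglongrightarrow> y"
    using x y by (auto simp: closure_sequential)
  then have "(\<lambda>n. f (u n) (v n)) \<longlonglongrightarrow> f x y"
    by (intro bounded_bilinear.tendsto[OF bl])
  then show ?thesis
    using L assms(3) uv(1,3) by (metis (no_types, lifting) closed_sequentially)
qed

text \<open>
  By the last assumption and fullness, an element \<open>b\<close> is approximated by sums of
  products \<open>\<langle>e, f\<rangle>b\<close>, and the linking identities move elements of \<open>J\<close> and \<open>K\<close> across the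
  bimodule.
\<close>

lemma Ind_eqI:
  fixes M :: "('a::complex_banach_algebra, 'b::complex_banach_algebra,
               'e::complex_banach, 'f::complex_banach) morita_data"
  assumes M: "morita_equivalence M" and J: "closed_ideal J" and K: "closed_ideal K"
    and JK: "closed_span {gt_left M a f | a f. a \<in> J} = closed_span {gt_right M f b | f b. b \<in> K}"
    and approx: "\<And>b::'b. b \<in> closure (range (\<lambda>c. c * b))"
  shows "Ind M J = K"
proof
  interpret morita_equivalence M by (rule M)
  have K': "closed K" "complex_vector.subspace K" "\<And>x y. y \<in> K \<Longrightarrow> x * y \<in> K"
    using K by (auto simp: closed_ideal_def)
  have span_B: "c \<in> closed_span {pairB M e f | e f. True}" for c
    unfolding pairB_full by simp
  show "Ind M J \<subseteq> K"
    unfolding Ind_def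
  proof (rule closed_span_least[OF _ K'(1,2)], clarify)
    fix \<eta> \<xi> assume \<eta>: "\<forall>\<zeta>. pairA M \<zeta> \<eta> \<in> J"
    have *: "c * pairB M \<eta> \<xi> \<in> K" for c
    proof (rule closed_span_mapsto_left[OF contractive_bilinear_mult K'(1,2) _ span_B], clarify)
      fix e f
      \<comment> \<open>In order: <e,f><\<eta>,\<xi>> = <<e,f>\<eta>, \<xi>> = <e a, \<xi>> = <e, a
        \<xi>> with a = \<open>pairA M f \<eta>\<close>, which lies in \<open>J\<close> by the
        choice of \<open>\<eta>\<close>. Since \<open>a \<xi>\<close> then belongs to the closed
        span of E^> K, the result can be moved into \<open>K\<close>.\<close>
      have eq: "pairB M e f * pairB M \<eta> \<xi> = pairB M e (gt_left M (pairA M f \<eta>) \<xi>)"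
        by (simp only: pairB_left[symmetric] pairB_balanced[symmetric] linking_lt)
      have "gt_left M (pairA M f \<eta>) \<xi> \<in> closed_span {gt_right M f b | f b. b \<in> K}"
        unfolding JK[symmetric] by (rule closed_span_base) (use \<eta> in blast)
      then show "pairB M e f * pairB M \<eta> \<xi> \<in> K"
        unfolding eq
        by (rule closed_span_mapsto_right[OF bilinear_pairB K'(1,2), rotated])
           (use K'(3) in \<open>auto simp: pairB_right\<close>)
    qed
    \<comment> \<open>So far only left multiples of the generator are known to be in
      \<open>K\<close>; \<open>approx\<close> recovers the generator from them.\<close>
    then have "closure (range (\<lambda>c. c * pairB M \<eta> \<xi>)) \<subseteq> K"
      using K'(1) by (intro closure_minimal) auto
    then show "pairB M \<eta> \<xi> \<in> K" using approx by blast
  qed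
  have Ind: "closed (Ind M J)" "complex_vector.subspace (Ind M J)"
    unfolding Ind_def by (rule closed_closed_span subspace_closed_span)+
  show "K \<subseteq> Ind M J"
  proof
    fix k assume k: "k \<in> K"
    have "c * k \<in> Ind M J" for c
    proof (rule closed_span_mapsto_left[OF contractive_bilinear_mult Ind _ span_B], clarify)
      fix e f
      have "gt_right M f k \<in> closed_span {gt_left M a f | a f. a \<in> J}"
        unfolding JK by (rule closed_span_base) (use k in blast)
      \<comment> \<open>The elements \<open>e a\<close> with \<open>a\<close> in \<open>J\<close>
        belong to E_J^<, because pairing them with any \<zeta> produces a right multiple by
        \<open>a\<close>.\<close>
      moreover have *: "pairB M e (gt_left M a f') \<in> Ind M J" if "a \<in> J" for a f'
      proof -
        have "pairA M \<zeta> (lt_right M e a) \<in> J" for \<zeta>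
          using J that by (simp add: pairA_right closed_ideal_def)
        then show ?thesis
          unfolding Ind_def pairB_balanced[symmetric] by (intro closed_span_base) blast
      qed
      ultimately have "pairB M e (gt_right M f k) \<in> Ind M J"
        by (elim closed_span_mapsto_right[OF bilinear_pairB Ind, rotated]) (use * in blast)
      then show "pairB M e f * k \<in> Ind M J" by (simp add: pairB_right)
    qed
    then have "closure (range (\<lambda>c. c * k)) \<subseteq> Ind M J"
      using Ind(1) by (intro closure_minimal) auto
    then show "k \<in> Ind M J" using approx by blast
  qed
qed

text \<open>An exact left unit \<open>u\<close> for a nearby \<open>d\<close> is an approximate one
  for \<open>b\<close>: the error u(b-d) + (d-b) has norm at most twice the distance from
  \<open>b\<close> to \<open>d\<close>, whence the choice of e/2. The unit may depend on
  \<open>d\<close>, so no approximating net is built.\<close>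

lemma left_approximate_unit:
  fixes D :: "'a::complex_banach_algebra set" and b :: 'a
  assumes D: "closure D = UNIV" and unit: "\<And>d. d \<in> D \<Longrightarrow> \<exists>u. norm u \<le> 1 \<and> u * d = d"
  shows "b \<in> closure (range (\<lambda>c. c * b))"
  unfolding closure_approachable
proof (intro allI impI)
  fix e :: real assume "0 < e"
  then obtain d where d: "d \<in> D" "dist d b < e / 2"
    using D closure_approachable[of b D] by (metis UNIV_I half_gt_zero)
  obtain u where u: "norm u \<le> 1" "u * d = d" using unit d by blast
  have "u * b - b = u * (b - d) + (d - b)"
    by (simp add: u(2) right_diff_distrib)
  then have "norm (u * b - b) \<le> norm (u * (b - d)) + norm (d - b)"
    by (metis norm_triangle_ineq)
  also have "\<dots> \<le> norm u * norm (b - d) + norm (d - b)"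
    by (simp add: norm_mult_ineq)
  also have "\<dots> \<le> 1 * norm (b - d) + norm (d - b)"
    using u(1) by (intro add_right_mono mult_right_mono) auto
  also have "\<dots> < e" using d(2) by (simp add: dist_norm norm_minus_commute)
  finally show "\<exists>y\<in>range (\<lambda>c. c * b). dist y b < e" by (auto simp: dist_norm)
qed

section \<open>Lattices of sets ordered by inclusion\<close>

lemma inclusion_order_simps [simp]:
  "carrier (inclusion_order D) = D" "le (inclusion_order D) = (\<subseteq>)" "eq (inclusion_order D) = (=)"
  by (simp_all add: inclusion_order_def)

lemma partial_order_inclusion_order: "partial_order (inclusion_order D)"
  by unfold_locales auto

text \<open>An order embedding carries least upper and greatest lower bounds of labels to those of
  the labelled sets, because the competing bounds range over the image of \<open>I\<close> only. In
  particular \<open>I (U \<union> V)\<close> is the join without being a union or a sum.\<close>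

lemma inclusion_order_lattice:
  assumes emb: "\<And>U V. U \<in> \<O> \<Longrightarrow> V \<in> \<O> \<Longrightarrow> I U \<subseteq> I V \<longleftrightarrow> U \<subseteq> V"
    and Un: "\<And>U V. U \<in> \<O> \<Longrightarrow> V \<in> \<O> \<Longrightarrow> U \<union> V \<in> \<O>"
    and Int: "\<And>U V. U \<in> \<O> \<Longrightarrow> V \<in> \<O> \<Longrightarrow> U \<inter> V \<in> \<O>"
  shows "lattice (inclusion_order (I ` \<O>))"
    and "\<And>U V. U \<in> \<O> \<Longrightarrow> V \<in> \<O> \<Longrightarrow> join (inclusion_order (I ` \<O>)) (I U) (I V) = I (U \<union> V)"
    and "\<And>U V. U \<in> \<O> \<Longrightarrow> V \<in> \<O> \<Longrightarrow> meet (inclusion_order (I ` \<O>)) (I U) (I V) = I (U \<inter> V)"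
proof -
  let ?L = "inclusion_order (I ` \<O>)"
  interpret partial_order ?L by (rule partial_order_inclusion_order)
  have least: "least ?L (I (U \<union> V)) (Upper ?L {I U, I V})" if "U \<in> \<O>" "V \<in> \<O>" for U V
  proof -
    have bound: "I U \<subseteq> I (U \<union> V)" "I V \<subseteq> I (U \<union> V)"
      using emb[OF that(1) Un[OF that]] emb[OF that(2) Un[OF that]] by blast+
    have bound': "I (U \<union> V) \<subseteq> I W" if "W \<in> \<O>" "I U \<subseteq> I W" "I V \<subseteq> I W" for W
      using emb[of U W] emb[of V W] emb[of "U \<union> V" W] that Un \<open>U \<in> \<O>\<close> \<open>V \<in> \<O>\<close> by blast
    show ?thesis
      unfolding least_def
    proof (intro conjI ballI)
      fix x assume "x \<in> Upper ?L {I U, I V}"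
      then have x: "x \<in> I ` \<O>" "I U \<subseteq> x" "I V \<subseteq> x"
        using that by (simp_all add: Upper_def all_conj_distrib)
      then show "le ?L (I (U \<union> V)) x"
        using bound' by (elim imageE) simp
    qed (use that Un[OF that] bound in \<open>simp_all add: Upper_def\<close>)
  qed
  have greatest: "greatest ?L (I (U \<inter> V)) (Lower ?L {I U, I V})" if "U \<in> \<O>" "V \<in> \<O>" for U V
  proof -
    have bound: "I (U \<inter> V) \<subseteq> I U" "I (U \<inter> V) \<subseteq> I V"
      using emb[OF Int[OF that] that(1)] emb[OF Int[OF that] that(2)] by blast+
    have bound': "I W \<subseteq> I (U \<inter> V)" if "W \<in> \<O>" "I W \<subseteq> I U" "I W \<subseteq> I V" for W
      using emb[of W U] emb[of W V] emb[of W "U \<inter> V"] that Int \<open>U \<in> \<O>\<close> \<open>V \<in> \<O>\<close> by blast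
    show ?thesis
      unfolding greatest_def
    proof (intro conjI ballI)
      fix x assume "x \<in> Lower ?L {I U, I V}"
      then have x: "x \<in> I ` \<O>" "x \<subseteq> I U" "x \<subseteq> I V"
        using that by (simp_all add: Lower_def all_conj_distrib)
      then show "le ?L x (I (U \<inter> V))"
        using bound' by (elim imageE) simp
    qed (use that Int[OF that] bound in \<open>simp_all add: Lower_def\<close>)
  qed
  show "lattice ?L"
  proof unfold_locales
    fix x y assume "x \<in> carrier ?L" "y \<in> carrier ?L"
    then obtain U V where UV: "U \<in> \<O>" "V \<in> \<O>" "x = I U" "y = I V" by auto
    show "\<exists>s. least ?L s (Upper ?L {x, y})" "\<exists>s. greatest ?L s (Lower ?L {x, y})"
      using least[OF UV(1,2)] greatest[OF UV(1,2)] UV(3,4) by blast+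
  qed
  show "join ?L (I U) (I V) = I (U \<union> V)" if "U \<in> \<O>" "V \<in> \<O>" for U V
    \<comment> \<open>\<open>sup\<close> is a Hilbert choice among the least upper bounds;
      antisymmetry makes the choice unique.\<close>
    unfolding join_def sup_def
    by (rule some_equality, rule least[OF that], erule least_unique, rule least[OF that])
  show "meet ?L (I U) (I V) = I (U \<inter> V)" if "U \<in> \<O>" "V \<in> \<O>" for U V
    unfolding meet_def inf_def
    by (rule some_equality, rule greatest[OF that], erule greatest_unique, rule greatest[OF that])
qed

text \<open>Labels are unique by \<open>emb\<close> and \<open>emb'\<close>, and on labels
  \<open>F\<close> acts as \<theta>; hence bijectivity and preservation of joins and meets can be
  read off from \<theta>.\<close>

lemma lattice_isomorphism_images:
  assumes emb: "\<And>U V. U \<in> \<O> \<Longrightarrow> V \<in> \<O> \<Longrightarrow> I U \<subseteq> I V \<longleftrightarrow> U \<subseteq> V"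
    and Un: "\<And>U V. U \<in> \<O> \<Longrightarrow> V \<in> \<O> \<Longrightarrow> U \<union> V \<in> \<O>"
    and Int: "\<And>U V. U \<in> \<O> \<Longrightarrow> V \<in> \<O> \<Longrightarrow> U \<inter> V \<in> \<O>"
    and emb': "\<And>U V. U \<in> \<O>' \<Longrightarrow> V \<in> \<O>' \<Longrightarrow> I' U \<subseteq> I' V \<longleftrightarrow> U \<subseteq> V"
    and Un': "\<And>U V. U \<in> \<O>' \<Longrightarrow> V \<in> \<O>' \<Longrightarrow> U \<union> V \<in> \<O>'"
    and Int': "\<And>U V. U \<in> \<O>' \<Longrightarrow> V \<in> \<O>' \<Longrightarrow> U \<inter> V \<in> \<O>'"
    and bij: "bij_betw \<theta> \<O> \<O>'"
    and \<theta>: "\<And>U V. U \<in> \<O> \<Longrightarrow> V \<in> \<O> \<Longrightarrow> \<theta> (U \<union> V) = \<theta> U \<union> \<theta> V"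
      "\<And>U V. U \<in> \<O> \<Longrightarrow> V \<in> \<O> \<Longrightarrow> \<theta> (U \<inter> V) = \<theta> U \<inter> \<theta> V"
    and F: "\<And>U. U \<in> \<O> \<Longrightarrow> F (I U) = I' (\<theta> U)"
  shows "lattice_isomorphism (inclusion_order (I ` \<O>)) (inclusion_order (I' ` \<O>')) F"
proof -
  have \<theta>': "\<theta> U \<in> \<O>'" if "U \<in> \<O>" for U using bij that by (auto simp: bij_betw_def)
  have inj: "inj_on I \<O>" "inj_on I' \<O>'"
    by (rule inj_onI, metis emb subset_antisym subset_refl)
       (rule inj_onI, metis emb' subset_antisym subset_refl)
  have "inj_on F (I ` \<O>)"
  proof (rule inj_onI, clarify)
    fix U V assume UV: "U \<in> \<O>" "V \<in> \<O>" "F (I U) = F (I V)"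
    then have "\<theta> U = \<theta> V" using inj(2) \<theta>' by (auto simp: F dest: inj_onD)
    then show "I U = I V" using bij UV by (auto simp: bij_betw_def dest: inj_onD)
  qed
  moreover have "F ` I ` \<O> = I' ` \<theta> ` \<O>" by (auto simp: image_iff F)
  then have "F ` I ` \<O> = I' ` \<O>'" using bij by (simp add: bij_betw_def)
  ultimately have "bij_betw F (I ` \<O>) (I' ` \<O>')" by (simp add: bij_betw_def)
  then show ?thesis
    unfolding lattice_isomorphism_def join_pres_def meet_pres_def
    using inclusion_order_lattice[where \<O> = \<O>, OF emb Un Int]
      inclusion_order_lattice[where \<O> = \<O>', OF emb' Un' Int']
    by (simp add: F Un Int \<theta> \<theta>')
qed

section \<open>Estimates for the l^p norm\<close>

lemma norm_le_lp_norm: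
  assumes "1 \<le> p" "i \<in> S"
  shows "ennreal (cmod (\<xi> i)) \<le> lp_norm p S \<xi>"
proof (cases "p = \<infinity>")
  case True
  then show ?thesis using assms by (auto simp: lp_norm_def intro: SUP_upper2)
next
  case False
  define q where "q = enn2real p"
  \<comment> \<open>\<open>enn2real\<close> sends \<infinity> to 0, so this relies on the separate
    treatment of that exponent.\<close>
  have "1 \<le> q"
    using assms(1) False by (cases p) (auto simp: q_def one_ennreal.rep_eq simp flip: ennreal_1)
  have "cmod (\<xi> i) \<le> (\<Sum>\<^sub>\<infinity>i\<in>S. cmod (\<xi> i) powr q) powr (1 / q)"
    if sm: "(\<lambda>i. cmod (\<xi> i) powr q) summable_on S"
  proof -
    have "cmod (\<xi> i) powr q \<le> (\<Sum>\<^sub>\<infinity>i\<in>S. cmod (\<xi> i) powr q)"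
      using finite_sum_le_infsum[OF sm, of "{i}"] assms(2) by simp
    then have "(cmod (\<xi> i) powr q) powr (1 / q) \<le> (\<Sum>\<^sub>\<infinity>i\<in>S. cmod (\<xi> i) powr q) powr (1 / q)"
      using \<open>1 \<le> q\<close> by (intro powr_mono2) auto
    then show ?thesis using \<open>1 \<le> q\<close> by (simp add: powr_powr)
  qed
  then show ?thesis
    unfolding lp_norm_def using False by (auto simp: q_def[symmetric] intro: ennreal_leI)
qed

lemma lp_norm_mono:
  assumes "\<And>i. i \<in> S \<Longrightarrow> cmod (\<xi> i) \<le> cmod (\<zeta> i)"
  shows "lp_norm p S \<xi> \<le> lp_norm p S \<zeta>"
proof (cases "p = \<infinity>")
  case True
  have "(SUP i\<in>S. ennreal (cmod (\<xi> i))) \<le> (SUP i\<in>S. ennreal (cmod (\<zeta> i)))"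
    using assms by (intro SUP_mono) (blast intro: ennreal_leI)
  then show ?thesis using True by (simp add: lp_norm_def)
next
  case False
  define q where "q = enn2real p"
  have q: "0 \<le> q" by (simp add: q_def)
  have le: "cmod (\<xi> i) powr q \<le> cmod (\<zeta> i) powr q" if "i \<in> S" for i
    using assms[OF that] q by (intro powr_mono2) auto
  \<comment> \<open>If the powers of \<zeta> are not summable, the right-hand norm is \<infinity> by
    definition; otherwise summability passes to \<xi> by comparison.\<close>
  have "(\<lambda>i. cmod (\<xi> i) powr q) summable_on S \<and>
      (\<Sum>\<^sub>\<infinity>i\<in>S. cmod (\<xi> i) powr q) powr (1 / q) \<le> (\<Sum>\<^sub>\<infinity>i\<in>S. cmod (\<zeta> i) powr q) powr (1 / q)"
    if sm: "(\<lambda>i. cmod (\<zeta> i) powr q) summable_on S"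
  proof
    show 1: "(\<lambda>i. cmod (\<xi> i) powr q) summable_on S"
      by (rule summable_on_comparison_test[OF sm]) (use le in auto)
    have "(\<Sum>\<^sub>\<infinity>i\<in>S. cmod (\<xi> i) powr q) \<le> (\<Sum>\<^sub>\<infinity>i\<in>S. cmod (\<zeta> i) powr q)"
      using 1 sm le by (rule infsum_mono)
    then show "(\<Sum>\<^sub>\<infinity>i\<in>S. cmod (\<xi> i) powr q) powr (1 / q)
        \<le> (\<Sum>\<^sub>\<infinity>i\<in>S. cmod (\<zeta> i) powr q) powr (1 / q)"
      using q by (intro powr_mono2) (auto intro: infsum_nonneg)
  qed
  then show ?thesis
    unfolding lp_norm_def using False by (auto simp: q_def[symmetric] intro: ennreal_leI)
qed

lemma lp_norm_delta:
  assumes "1 \<le> p" "x \<in> S"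
  shows "lp_norm p S (\<lambda>i. if i = x then 1 else 0) \<le> 1"
proof (cases "p = \<infinity>")
  case True
  then show ?thesis by (auto simp: lp_norm_def intro!: SUP_least)
next
  case False
  let ?g = "\<lambda>i. cmod (if i = x then 1 else 0) powr enn2real p"
  have "(?g has_sum (\<Sum>i\<in>{x}. ?g i)) S"
    by (rule has_sum_finite_neutralI[of "{x}"]) (use assms in auto)
  then have "(?g has_sum 1) S" by simp
  then show ?thesis
    using False infsumI summable_on_def by (fastforce simp: lp_norm_def)
qed

section \<open>Fibrewise sums along local homeomorphisms\<close>

text \<open>The local formula \<open>g\<close> may change from point to point. This suits extensions
  by zero and fibrewise sums, where no single formula is visibly continuous everywhere.\<close>

lemma continuous_map_locally:
  assumes "\<And>x. x \<in> topspace X \<Longrightarrow>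
    \<exists>T g. openin X T \<and> x \<in> T \<and> continuous_map (subtopology X T) Y g \<and> (\<forall>y\<in>T. f y = g y)"
  shows "continuous_map X Y f"
proof -
  let ?I = "{T. openin X T \<and> continuous_map (subtopology X T) Y f}"
  have "\<exists>T\<in>?I. x \<in> T" if "x \<in> topspace X" for x
  proof -
    obtain T g where T: "openin X T" "x \<in> T" "continuous_map (subtopology X T) Y g"
      "\<forall>y\<in>T. f y = g y"
      using assms[OF \<open>x \<in> topspace X\<close>] by blast
    then have "continuous_map (subtopology X T) Y f"
      by (elim continuous_map_eq) auto
    then show ?thesis using T by blast
  qed
  then have cover: "\<exists>T. T \<in> ?I \<and> x \<in> T \<and> f x = f x" if "x \<in> topspace X" for x
    using that by blast
  show ?thesis
    by (rule pasting_lemma[where I="?I" and T="\<lambda>T. T" and f="\<lambda>_. f", OF _ _ _ cover]) simp_all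
qed

text \<open>Replaces the closure of the support, taken in \<open>S\<close>, by any compact subset of
  \<open>S\<close> outside which the function vanishes. Continuity on all of \<open>X\<close> is
  obtained by gluing: a compact set is closed in a Hausdorff space, so off \<open>S\<close> the
  function is locally zero.\<close>

lemma Cc_subtopology_iff:
  assumes X: "Hausdorff_space X" and S: "openin X S"
  shows "f \<in> Cc (subtopology X S) \<longleftrightarrow> continuous_map X euclidean f \<and>
     (\<exists>K. compactin X K \<and> K \<subseteq> S \<and> (\<forall>x. x \<notin> K \<longrightarrow> f x = 0))"
proof
  have top: "topspace (subtopology X S) = S" using openin_subset[OF S] by (simp add: inf.absorb2)
  {
    assume f: "f \<in> Cc (subtopology X S)"
    define K where "K = subtopology X S closure_of {x \<in> S. f x \<noteq> 0}"
    have "compactin (subtopology X S) K"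
      using f unfolding Cc_def top K_def by blast
    then have K: "compactin X K" "K \<subseteq> S" by (simp_all add: compactin_subtopology)
    have zero: "f x = 0" if "x \<notin> K" for x
    proof (cases "x \<in> S")
      case True
      then show ?thesis
        using that closure_of_subset[of "{x \<in> S. f x \<noteq> 0}" "subtopology X S"]
        unfolding K_def top by blast
    next
      case False
      then show ?thesis using f unfolding Cc_def top by blast
    qed
    have "continuous_map X euclidean f"
    proof (rule continuous_map_locally)
      fix x assume x: "x \<in> topspace X"
      show "\<exists>T g. openin X T \<and> x \<in> T \<and> continuous_map (subtopology X T) euclidean g \<and>
          (\<forall>y\<in>T. f y = g y)"
      proof (cases "x \<in> S")
        case True
        then show ?thesis using S f by (auto simp: Cc_def)
      next
        case False
        have "openin X (topspace X - K)"
          using K X compactin_imp_closedin by blast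
        then show ?thesis using False x K zero
          by (intro exI[of _ "topspace X - K"] exI[of _ "\<lambda>_. 0"]) auto
      qed
    qed
    then show "continuous_map X euclidean f \<and>
       (\<exists>K. compactin X K \<and> K \<subseteq> S \<and> (\<forall>x. x \<notin> K \<longrightarrow> f x = 0))"
      using K zero by blast
  }
  {
    assume "continuous_map X euclidean f \<and>
       (\<exists>K. compactin X K \<and> K \<subseteq> S \<and> (\<forall>x. x \<notin> K \<longrightarrow> f x = 0))"
    then obtain K where f: "continuous_map X euclidean f"
      and K: "compactin X K" "K \<subseteq> S" "\<And>x. x \<notin> K \<Longrightarrow> f x = 0" by blast
    have KS: "compactin (subtopology X S) K" using K by (simp add: compactin_subtopology)
    then have "closedin (subtopology X S) K"
      using X Hausdorff_space_subtopology compactin_imp_closedin by blast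
    then have "subtopology X S closure_of {x \<in> S. f x \<noteq> 0} \<subseteq> K"
      using K by (intro closure_of_minimal) auto
    then have "compactin (subtopology X S) (subtopology X S closure_of {x \<in> S. f x \<noteq> 0})"
      using KS by (meson closed_compactin closedin_closure_of)
    then show "f \<in> Cc (subtopology X S)"
      using f K unfolding Cc_def top by (auto intro: continuous_map_from_subtopology)
  }
qed

lemma Cc_iff:
  assumes "Hausdorff_space X"
  shows "f \<in> Cc X \<longleftrightarrow>
    continuous_map X euclidean f \<and> (\<exists>K. compactin X K \<and> (\<forall>x. x \<notin> K \<longrightarrow> f x = 0))"
  using Cc_subtopology_iff[OF assms openin_topspace, of f] compactin_subset_topspace
  by (auto simp: subtopology_topspace)

lemma Cc_subtopology_subset:
  assumes "Hausdorff_space X" "openin X S" "openin X T" "S \<subseteq> T"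
  shows "Cc (subtopology X S) \<subseteq> Cc (subtopology X T)"
proof
  fix f assume "f \<in> Cc (subtopology X S)"
  then obtain K where "continuous_map X euclidean f" "compactin X K" "K \<subseteq> S" "\<forall>x. x \<notin> K \<longrightarrow> f x = 0"
    using assms by (auto simp: Cc_subtopology_iff)
  then show "f \<in> Cc (subtopology X T)"
    unfolding Cc_subtopology_iff[OF assms(1,3)] using assms(4) by (intro conjI exI[of _ K]) auto
qed

lemma Cc_subtopology_subset_Cc:
  assumes "Hausdorff_space X" "openin X S"
  shows "Cc (subtopology X S) \<subseteq> Cc X"
  using assms by (auto simp: Cc_subtopology_iff Cc_iff)

lemma Cc_add: 
  assumes X: "Hausdorff_space X" and fg: "f \<in> Cc X" "g \<in> Cc X"
  shows "(\<lambda>x. f x + g x) \<in> Cc X"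
proof -
  obtain K L where "compactin X K" "\<And>x. x \<notin> K \<Longrightarrow> f x = 0" "compactin X L" "\<And>x. x \<notin> L \<Longrightarrow> g x = 0"
    using fg X by (auto simp: Cc_iff)
  then show ?thesis
    using fg X unfolding Cc_iff[OF X]
    by (intro conjI exI[of _ "K \<union> L"]) (auto intro: continuous_map_add compactin_Un)
qed

lemma Cc_scale: 
  assumes X: "Hausdorff_space X" and f: "f \<in> Cc X"
  shows "(\<lambda>x. c * f x) \<in> Cc X"
proof -
  have "continuous_map X euclidean (\<lambda>x. c * f x)"
    using f by (auto simp: Cc_def continuous_map_atin intro: tendsto_mult)
  then show ?thesis using f X unfolding Cc_iff[OF X] by auto
qed

text \<open>Local compactness puts an open \<open>W\<close> and a compact \<open>L\<close> between
  \<open>K\<close> and \<open>S\<close>; a Urysohn function for \<open>K\<close> and the complement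
  of \<open>W\<close> then has its nonzero values inside \<open>L\<close>.\<close>

lemma Cc_bump:
  assumes X: "Hausdorff_space X" "locally_compact_space X"
    and K: "compactin X K" and S: "openin X S" "K \<subseteq> S"
  obtains u where "u \<in> Cc (subtopology X S)" "\<And>x. x \<in> K \<Longrightarrow> u x = 1" "\<And>x. cmod (u x) \<le> 1"
proof -
  have creg: "completely_regular_space X"
    using X by (simp add: locally_compact_regular_imp_completely_regular_space)
  have "locally_compact_space (subtopology X S)"
    using X S by (simp add: locally_compact_space_open_subset)
  then obtain W L where W: "openin (subtopology X S) W" "compactin (subtopology X S) L"
      "K \<subseteq> W" "W \<subseteq> L"
    using X K S compactin_subtopology Hausdorff_space_subtopology[OF X(1), of S]
    by (metis locally_compact_space_compact_closed_compact)
  then have W': "openin X W" "compactin X L" "L \<subseteq> S"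
    using S by (auto simp: compactin_subtopology openin_open_subtopology)
  obtain f :: "_ \<Rightarrow> real" where f: "continuous_map X (top_of_set {0..1}) f"
      "f ` (topspace X - W) \<subseteq> {0}" "f ` K \<subseteq> {1}"
    using Urysohn_completely_regular_compact_closed[of 0 1 X K "topspace X - W"] creg K W W'(1)
    by (auto simp: disjnt_iff)
  \<comment> \<open>On the space this is \<open>f\<close> itself, which vanishes off
    \<open>W\<close>; cutting down to \<open>W\<close> also fixes the value 0 at points outside
    \<open>topspace X\<close>, where \<open>f\<close> is arbitrary.\<close>
  define u where "u = (\<lambda>x. if x \<in> W then complex_of_real (f x) else 0)"
  have fc: "continuous_map X euclidean f" "\<And>x. x \<in> topspace X \<Longrightarrow> f x \<in> {0..1}"
    using f(1) by (auto simp: continuous_map_in_subtopology)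
  have "continuous_map X euclidean (\<lambda>x. complex_of_real (f x))"
    using fc(1) by (auto simp: continuous_map_atin intro: tendsto_of_real)
  then have "continuous_map X euclidean u"
    by (elim continuous_map_eq) (use f in \<open>auto simp: u_def\<close>)
  then have "u \<in> Cc (subtopology X S)"
    using W W' X S unfolding Cc_subtopology_iff[OF X(1) S(1)] by (auto simp: u_def)
  moreover have "u x = 1" if "x \<in> K" for x using that W f(3) by (auto simp: u_def)
  moreover have "cmod (u x) \<le> 1" for x
    using fc(2)[of x] W' openin_subset by (fastforce simp: u_def)
  ultimately show thesis using that by blast
qed

section \<open>Local homeomorphisms: sections and finite fibres\<close>

lemma local_homeomorphismD:
  assumes q: "local_homeomorphism X Y q"
  shows "continuous_map X Y q" "open_map X Y q"
    "\<And>x. x \<in> topspace X \<Longrightarrow> \<exists>U. openin X U \<and> x \<in> U \<and> inj_on q U"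
proof -
  have loc: "\<exists>U V. openin X U \<and> x \<in> U \<and> openin Y V \<and> inj_on q U \<and>
      homeomorphic_map (subtopology X U) (subtopology Y V) q" if "x \<in> topspace X" for x
  proof -
    obtain U V where UV: "openin X U" "x \<in> U" "openin Y V"
        "homeomorphic_map (subtopology X U) (subtopology Y V) q"
      using q \<open>x \<in> topspace X\<close> unfolding local_homeomorphism_def by blast
    moreover have "inj_on q U"
      using homeomorphic_imp_injective_map[OF UV(4)] openin_subset[OF UV(1)]
      by (simp add: inf.absorb2)
    ultimately show ?thesis by blast
  qed
  then show "\<And>x. x \<in> topspace X \<Longrightarrow> \<exists>U. openin X U \<and> x \<in> U \<and> inj_on q U" by blast
  show "continuous_map X Y q"
  proof (rule continuous_map_locally)
    fix x assume "x \<in> topspace X"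
    with loc obtain U V where UV: "openin X U" "x \<in> U" "openin Y V"
        "homeomorphic_map (subtopology X U) (subtopology Y V) q" by metis
    then have "continuous_map (subtopology X U) Y q"
      using homeomorphic_imp_continuous_map continuous_map_into_fulltopology by blast
    then show "\<exists>T g. openin X T \<and> x \<in> T \<and> continuous_map (subtopology X T) Y g \<and> (\<forall>y\<in>T. q y = g y)"
      using UV by blast
  qed
  show "open_map X Y q"
    unfolding open_map_def
  proof (intro allI impI)
    fix W assume W: "openin X W"
    show "openin Y (q ` W)"
    proof (subst openin_subopen, clarify)
      fix x assume x: "x \<in> W"
      with W openin_subset obtain U V where UV: "openin X U" "x \<in> U" "openin Y V"
          "homeomorphic_map (subtopology X U) (subtopology Y V) q" 
        by (metis loc subsetD)
      have "openin (subtopology X U) (W \<inter> U)"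
        using W UV by (simp add: openin_open_subtopology openin_Int)
      then have "openin (subtopology Y V) (q ` (W \<inter> U))"
        using homeomorphic_imp_open_map[OF UV(4)] by (simp add: open_map_def)
      then have "openin Y (q ` (W \<inter> U))" using UV(3) openin_trans_full by blast
      then show "\<exists>T. openin Y T \<and> q x \<in> T \<and> T \<subseteq> q ` W" using x UV by blast
    qed
  qed
qed

lemma open_injective_section:
  assumes q: "continuous_map X Y q" "open_map X Y q" and S: "openin X S" "inj_on q S"
  obtains g where "continuous_map (subtopology Y (q ` S)) X g" "\<And>x. x \<in> S \<Longrightarrow> g (q x) = x"
proof -
  have top: "topspace (subtopology X S) = S" "topspace (subtopology Y (q ` S)) = q ` S"
    using S(1) q openin_subset by (auto simp: open_map_def) blast+
  have "homeomorphic_map (subtopology X S) (subtopology Y (q ` S)) q"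
  proof (rule bijective_open_imp_homeomorphic_map)
    show "continuous_map (subtopology X S) (subtopology Y (q ` S)) q"
      using q(1) by (auto simp: continuous_map_in_subtopology continuous_map_from_subtopology)
    show "open_map (subtopology X S) (subtopology Y (q ` S)) q"
      using q(2) S(1) by (auto simp: open_map_def openin_open_subtopology)
  qed (simp_all only: top S(2))
  then obtain g where "homeomorphic_maps (subtopology X S) (subtopology Y (q ` S)) q g"
    by (auto simp: homeomorphic_map_maps)
  then show thesis
    using top that[of g] by (auto simp: homeomorphic_maps_def continuous_map_in_subtopology)
qed

lemma Hausdorff_disjoint_neighbourhoods:
  assumes X: "Hausdorff_space X" and F: "finite F" "F \<subseteq> topspace X"
    and U: "\<And>x. x \<in> F \<Longrightarrow> openin X (U x) \<and> x \<in> U x"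
  obtains S where "\<And>x. x \<in> F \<Longrightarrow> openin X (S x) \<and> x \<in> S x \<and> S x \<subseteq> U x"
    "\<And>x y. x \<in> F \<Longrightarrow> y \<in> F \<Longrightarrow> x \<noteq> y \<Longrightarrow> S x \<inter> S y = {}"
proof -
  have "\<exists>P Q. openin X P \<and> openin X Q \<and> x \<in> P \<and> y \<in> Q \<and> disjnt P Q"
    if "x \<in> F" "y \<in> F" "x \<noteq> y" for x y
    using X F that unfolding Hausdorff_space_def by blast
  then obtain P Q where PQ: "\<And>x y. x \<in> F \<Longrightarrow> y \<in> F \<Longrightarrow> x \<noteq> y \<Longrightarrow>
      openin X (P x y) \<and> openin X (Q x y) \<and> x \<in> P x y \<and> y \<in> Q x y \<and> disjnt (P x y) (Q x y)"
    by metis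
  \<comment> \<open>The pair chosen for (x, y) need not be the swap of the pair chosen for (y, x).
    Taking both neighbourhoods of \<open>x\<close> ensures that \<open>S x\<close> lies in
    \<open>P x y\<close> while \<open>S y\<close> lies in \<open>Q x y\<close>.\<close>
  define S where "S x = U x \<inter> (\<Inter>y\<in>F - {x}. P x y \<inter> Q y x)" for x
  show thesis
  proof (rule that[of S])
    fix x assume x: "x \<in> F"
    have "openin X (S x)"
    \<comment> \<open>An empty intersection is the whole type, which need not be open in
      \<open>X\<close>.\<close>
    proof (cases "F - {x} = {}")
      case True
      show ?thesis unfolding S_def True using U[OF x] by simp
    next
      case False
      then show ?thesis
        unfolding S_def using x F U PQ by (intro openin_Int openin_Inter) auto
    qed
    then show "openin X (S x) \<and> x \<in> S x \<and> S x \<subseteq> U x"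
      using x U PQ by (auto simp: S_def)
  next
    fix x y assume xy: "x \<in> F" "y \<in> F" "x \<noteq> y"
    then have "S x \<subseteq> P x y" "S y \<subseteq> Q x y" by (auto simp: S_def)
    then show "S x \<inter> S y = {}" using PQ[OF xy] unfolding disjnt_iff by blast
  qed
qed

text \<open>The part of a fibre inside \<open>K\<close> is closed in \<open>K\<close>, hence
  compact, and is covered by finitely many open sets on which \<open>q\<close> is injective; each of
  these contains at most one of its points.\<close>

lemma finite_compact_fibre:
  assumes X: "Hausdorff_space X" and Y: "Hausdorff_space Y"
    and q: "local_homeomorphism X Y q" and K: "compactin X K"
  shows "finite {x \<in> K. q x = y}"
proof (cases "y \<in> topspace Y")
  case True
  let ?F = "{x \<in> K. q x = y}"
  have "closedin X {x \<in> topspace X. q x \<in> {y}}"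
    using True Y local_homeomorphismD(1)[OF q]
    by (intro closedin_continuous_map_preimage) (auto intro: closedin_Hausdorff_singleton)
  then have "compactin X (K \<inter> {x \<in> topspace X. q x \<in> {y}})"
    using K compact_Int_closedin by blast
  moreover have "K \<inter> {x \<in> topspace X. q x \<in> {y}} = ?F"
    using compactin_subset_topspace[OF K] by auto
  ultimately have F: "compactin X ?F" by simp
  then have "?F \<subseteq> \<Union>{U. openin X U \<and> inj_on q U}"
    using local_homeomorphismD(3)[OF q] compactin_subset_topspace by fastforce
  then obtain \<U> where \<U>: "finite \<U>" "\<U> \<subseteq> {U. openin X U \<and> inj_on q U}" "?F \<subseteq> \<Union>\<U>"
    using F unfolding compactin_def by (metis (no_types, lifting) mem_Collect_eq)
  have "finite (?F \<inter> U)" if "U \<in> \<U>" for U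
  proof -
    have "inj_on q (?F \<inter> U)" using \<U> that by (auto intro: inj_on_subset)
    moreover have "q ` (?F \<inter> U) \<subseteq> {y}" by auto
    ultimately show ?thesis by (meson finite.emptyI finite.insertI finite_imageD finite_subset)
  qed
  then have "finite (\<Union>U\<in>\<U>. ?F \<inter> U)" using \<U>(1) by blast
  then show ?thesis by (rule finite_subset[rotated]) (use \<U>(3) in auto)
next
  case False
  then have "{x \<in> K. q x = y} = {}"
    using local_homeomorphismD(1)[OF q] compactin_subset_topspace[OF K]
    by (auto simp: continuous_map_def)
  then show ?thesis by (simp only: finite.emptyI)
qed

text \<open>
  Near \<open>z\<close> the part of the fibre inside \<open>K\<close> is the union of the images of finitely many local
  sections of \<open>q\<close> with disjoint ranges.
\<close>

lemma continuous_map_fibre_sum: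
  fixes F :: "'x \<times> 'z \<Rightarrow> 'c::{real_normed_vector}"
  assumes X: "Hausdorff_space X" and Y: "Hausdorff_space Y"
    and q: "local_homeomorphism X Y q" and K: "compactin X K"
    and \<rho>: "continuous_map Z Y \<rho>"
    and F: "continuous_map (subtopology (prod_topology X Z) {(x, z). q x = \<rho> z}) euclidean F"
    and zero: "\<And>x z. x \<in> topspace X \<Longrightarrow> z \<in> topspace Z \<Longrightarrow> q x = \<rho> z \<Longrightarrow> x \<notin> K \<Longrightarrow> F (x, z) = 0"
  shows "continuous_map Z euclidean (\<lambda>z. \<Sum>\<^sub>\<infinity>x\<in>{x \<in> topspace X. q x = \<rho> z}. F (x, z))"
proof (rule continuous_map_locally)
  fix z0 assume z0: "z0 \<in> topspace Z"
  note qc = local_homeomorphismD(1)[OF q] and qo = local_homeomorphismD(2)[OF q]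
  have KX: "K \<subseteq> topspace X" using K compactin_subset_topspace by blast
  define K0 where "K0 = {x \<in> K. q x = \<rho> z0}"
  have K0: "finite K0" unfolding K0_def by (rule finite_compact_fibre[OF X Y q K])
  have "\<exists>U. openin X U \<and> x \<in> U \<and> inj_on q U" if "x \<in> K0" for x
    using local_homeomorphismD(3)[OF q] that KX by (auto simp: K0_def)
  then obtain U where U: "\<And>x. x \<in> K0 \<Longrightarrow> openin X (U x) \<and> x \<in> U x \<and> inj_on q (U x)" by metis
  obtain S where S: "\<And>x. x \<in> K0 \<Longrightarrow> openin X (S x) \<and> x \<in> S x \<and> S x \<subseteq> U x"
    and disj: "\<And>x y. x \<in> K0 \<Longrightarrow> y \<in> K0 \<Longrightarrow> x \<noteq> y \<Longrightarrow> S x \<inter> S y = {}"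
    by (rule Hausdorff_disjoint_neighbourhoods[OF X K0, of U]) (use U KX in \<open>auto simp: K0_def\<close>)
  have "\<exists>g. continuous_map (subtopology Y (q ` S x)) X g \<and> (\<forall>y\<in>S x. g (q y) = y)" if "x \<in> K0" for x
    using open_injective_section[OF qc qo, of "S x"] S[OF that] U[OF that] inj_on_subset by metis
  then obtain g where g: "\<And>x. x \<in> K0 \<Longrightarrow> continuous_map (subtopology Y (q ` S x)) X (g x)"
    and gq: "\<And>x y. x \<in> K0 \<Longrightarrow> y \<in> S x \<Longrightarrow> g x (q y) = y" by metis
  \<comment> \<open>\<open>K1\<close> is the part of \<open>K\<close> that the chosen neighbourhoods
    miss. It is compact and contains no point over \<open>\<rho> z0\<close>, so its image is a
    closed set that can be avoided.\<close>
  define K1 where "K1 = K - (\<Union>x\<in>K0. S x)"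
  have "K1 = K \<inter> (topspace X - (\<Union>x\<in>K0. S x))" using KX by (auto simp: K1_def)
  moreover have "closedin X (topspace X - (\<Union>x\<in>K0. S x))" using S by blast
  ultimately have "compactin X K1" using K compact_Int_closedin by metis
  then have "closedin Y (q ` K1)" using qc Y image_compactin compactin_imp_closedin by metis
  \<comment> \<open>Over \<open>N\<close> every section is defined, and the fibre meets
    \<open>K\<close> only inside the sets \<open>S x\<close>.\<close>
  define N where "N = (topspace Y - q ` K1) \<inter> (\<Inter>x\<in>K0. q ` S x)"
  have N: "openin Y N"
  proof (cases "K0 = {}")
    case True
    then show ?thesis using \<open>closedin Y (q ` K1)\<close> by (simp add: N_def openin_diff)
  next
    case False
    then show ?thesis
      unfolding N_def using \<open>closedin Y (q ` K1)\<close> K0 S qo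
      by (intro openin_Int openin_Inter) (auto simp: open_map_def)
  qed
  define T where "T = {z \<in> topspace Z. \<rho> z \<in> N}"
  have "openin Z T" unfolding T_def using N \<rho> openin_continuous_map_preimage by blast
  moreover have "z0 \<in> T"
  proof -
    have "\<rho> z0 \<in> topspace Y" using \<rho> z0 by (auto simp: continuous_map_def)
    moreover have "\<rho> z0 \<notin> q ` K1" using S by (auto simp: K1_def K0_def)
    moreover have "\<rho> z0 \<in> q ` S x" if "x \<in> K0" for x
    proof -
      have "q x = \<rho> z0" using that by (simp add: K0_def)
      then show ?thesis using S[OF that] by (metis imageI)
    qed
    ultimately show ?thesis using z0 by (auto simp: T_def N_def)
  qed
  moreover have "continuous_map (subtopology Z T) euclidean (\<lambda>z. \<Sum>x\<in>K0. F (g x (\<rho> z), z))"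
  proof (rule continuous_map_sum[OF K0])
    fix x assume x: "x \<in> K0"
    have "continuous_map (subtopology Z T) (subtopology Y (q ` S x)) \<rho>"
      using \<rho> x by (auto simp: continuous_map_in_subtopology T_def N_def
          intro: continuous_map_from_subtopology)
    from continuous_map_compose[OF this g[OF x]]
    have "continuous_map (subtopology Z T) X (\<lambda>z. g x (\<rho> z))" by (simp add: o_def)
    then have "continuous_map (subtopology Z T) (prod_topology X Z) (\<lambda>z. (g x (\<rho> z), z))"
      by (simp add: continuous_map_paired continuous_map_from_subtopology)
    moreover have "q (g x (\<rho> z)) = \<rho> z" if "z \<in> T" for z
      using that x gq by (auto simp: T_def N_def)
    ultimately have "continuous_map (subtopology Z T)
        (subtopology (prod_topology X Z) {(x, z). q x = \<rho> z}) (\<lambda>z. (g x (\<rho> z), z))"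
      by (auto simp: continuous_map_in_subtopology)
    from continuous_map_compose[OF this F]
    show "continuous_map (subtopology Z T) euclidean (\<lambda>z. F (g x (\<rho> z), z))"
      by (simp add: o_def)
  qed
  moreover have "(\<Sum>\<^sub>\<infinity>x\<in>{x \<in> topspace X. q x = \<rho> z}. F (x, z)) = (\<Sum>x\<in>K0. F (g x (\<rho> z), z))"
    if z: "z \<in> T" for z
  proof -
    let ?\<sigma> = "\<lambda>x. g x (\<rho> z)"
    have \<sigma>: "?\<sigma> x \<in> S x" "q (?\<sigma> x) = \<rho> z" if "x \<in> K0" for x
      using z that gq by (auto simp: T_def N_def)
    have inj: "inj_on ?\<sigma> K0"
      using disj \<sigma>(1) by (intro inj_onI) (metis IntI empty_iff)
    \<comment> \<open>A point \<open>?\<sigma> x\<close> may leave \<open>K\<close> as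
      \<open>z\<close> moves. It is kept, with value zero, so that the finite index set
      \<open>K0\<close> stays the same near \<open>z0\<close>.\<close>
    have "(\<Sum>\<^sub>\<infinity>x\<in>{x \<in> topspace X. q x = \<rho> z}. F (x, z)) = (\<Sum>\<^sub>\<infinity>x\<in>?\<sigma> ` K0. F (x, z))"
    proof (rule infsum_cong_neutral)
      fix x assume x: "x \<in> {x \<in> topspace X. q x = \<rho> z} - ?\<sigma> ` K0"
      have "x \<notin> K"
      proof
        assume "x \<in> K"
        moreover have "q x \<notin> q ` K1" using x z by (auto simp: T_def N_def)
        ultimately obtain x' where "x' \<in> K0" "x \<in> S x'"
          unfolding K1_def by blast
        then have "x = ?\<sigma> x'" using gq x by force
        then show False using x \<open>x' \<in> K0\<close> by blast
      qed
      then show "F (x, z) = 0" using zero x z by (auto simp: T_def)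
    next
      fix x assume x: "x \<in> ?\<sigma> ` K0 - {x \<in> topspace X. q x = \<rho> z}"
      then show "F (x, z) = 0" using \<sigma> S openin_subset by blast
    qed simp
    also have "\<dots> = (\<Sum>x\<in>K0. F (?\<sigma> x, z))"
      using K0 inj by (simp add: sum.reindex)
    finally show ?thesis .
  qed
  ultimately show "\<exists>T g. openin Z T \<and> z0 \<in> T \<and> continuous_map (subtopology Z T) euclidean g \<and>
      (\<forall>z\<in>T. (\<Sum>\<^sub>\<infinity>x\<in>{x \<in> topspace X. q x = \<rho> z}. F (x, z)) = g z)"
    by (intro exI conjI) auto
qed

section \<open>Convolution actions and dynamical ideals\<close>

context groupoid
begin

lemma unit_arrow: "x \<in> units G \<Longrightarrow> x \<in> arrows G"
  by (auto simp: units_def src_arrow)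

lemma src_of_unit: "x \<in> units G \<Longrightarrow> gsrc G x = x"
  by (auto simp: units_def src_src)

lemma rng_of_unit: "x \<in> units G \<Longrightarrow> grng G x = x"
  by (auto simp: units_def rng_src)

lemma src_in_units: "\<gamma> \<in> arrows G \<Longrightarrow> gsrc G \<gamma> \<in> units G"
  by (simp add: units_def)

lemma rng_in_units: "\<gamma> \<in> arrows G \<Longrightarrow> grng G \<gamma> \<in> units G"
  using src_rng[of \<gamma>] rng_arrow[of \<gamma>] src_in_units[of "grng G \<gamma>"] by simp

lemma inv_of_unit: "x \<in> units G \<Longrightarrow> ginv G x = x"
  using inv_left[of x] src_unit[of "ginv G x"] src_inv[of x] inv_arrow[of x]
  by (simp add: unit_arrow src_of_unit rng_of_unit)

lemma inv_unique:
  assumes "\<gamma> \<in> arrows G" "\<eta> \<in> arrows G" "gsrc G \<gamma> = grng G \<eta>" "gmult G \<gamma> \<eta> = grng G \<gamma>"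
  shows "ginv G \<gamma> = \<eta>"
proof -
  have "gmult G (gmult G (ginv G \<gamma>) \<gamma>) \<eta> = gmult G (ginv G \<gamma>) (gmult G \<gamma> \<eta>)"
    using assms by (simp add: mult_assoc inv_arrow src_inv)
  then have "gmult G (grng G \<eta>) \<eta> = gmult G (ginv G \<gamma>) (gsrc G (ginv G \<gamma>))"
    using assms by (simp add: inv_left src_inv)
  then show ?thesis using assms by (simp add: rng_unit src_unit inv_arrow)
qed

lemma inv_inv: "\<gamma> \<in> arrows G \<Longrightarrow> ginv G (ginv G \<gamma>) = \<gamma>"
  by (rule inv_unique) (simp_all add: inv_arrow src_inv rng_inv inv_left)

lemma mult_inv_cancel:
  assumes "\<gamma> \<in> arrows G" "\<eta> \<in> arrows G" "grng G \<gamma> = grng G \<eta>"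
  shows "gmult G \<gamma> (gmult G (ginv G \<gamma>) \<eta>) = \<eta>"
  using assms mult_assoc[of \<gamma> "ginv G \<gamma>" \<eta>]
  by (simp add: inv_arrow src_inv rng_inv inv_right rng_unit)

lemma inv_mult:
  assumes "\<gamma> \<in> arrows G" "\<eta> \<in> arrows G" "gsrc G \<gamma> = grng G \<eta>"
  shows "ginv G (gmult G \<gamma> \<eta>) = gmult G (ginv G \<eta>) (ginv G \<gamma>)"
proof (rule inv_unique)
  have "gmult G (gmult G \<gamma> \<eta>) (gmult G (ginv G \<eta>) (ginv G \<gamma>)) =
      gmult G \<gamma> (gmult G \<eta> (gmult G (ginv G \<eta>) (ginv G \<gamma>)))"
    using assms by (intro mult_assoc) (simp_all add: mult_arrow inv_arrow src_inv rng_inv rng_mult)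
  also have "\<dots> = grng G \<gamma>"
    using assms by (simp add: mult_inv_cancel inv_arrow rng_inv inv_right)
  finally show "gmult G (gmult G \<gamma> \<eta>) (gmult G (ginv G \<eta>) (ginv G \<gamma>)) = grng G (gmult G \<gamma> \<eta>)"
    using assms by (simp add: rng_mult)
qed (use assms in \<open>simp_all add: mult_arrow inv_arrow src_inv rng_inv rng_mult src_mult\<close>)

text \<open>Invariance is stated in one direction only; the other one is the same condition at the
  inverse arrow.\<close>

lemma invariant_iff:
  assumes "open_invariant G U" "\<gamma> \<in> arrows G"
  shows "grng G \<gamma> \<in> U \<longleftrightarrow> gsrc G \<gamma> \<in> U"
  using assms inv_arrow[OF assms(2)] src_inv[OF assms(2)] rng_inv[OF assms(2)]
  unfolding open_invariant_def by metis

end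

lemma topspace_gtop: "topspace (gtop G) = arrows G"
  by (simp add: arrows_def)

lemma open_invariant_Un:
  "open_invariant G U \<Longrightarrow> open_invariant G V \<Longrightarrow> open_invariant G (U \<union> V)"
  unfolding open_invariant_def by blast

lemma open_invariant_Int:
  "open_invariant G U \<Longrightarrow> open_invariant G V \<Longrightarrow> open_invariant G (U \<inter> V)"
  unfolding open_invariant_def by blast

context etale_groupoid
begin

text \<open>If \<gamma> and its source lie in a common set on which the source map is injective,
  they coincide, since they have the same source. Openness is what allows bump functions on the unit
  space to be extended by zero to elements of C_c(G).\<close>

lemma openin_units: "openin (gtop G) (units G)"
proof (subst openin_subopen, intro ballI)
  fix x assume x: "x \<in> units G"
  obtain U where U: "openin (gtop G) U" "x \<in> U" "inj_on (gsrc G) U"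
    using local_homeomorphismD(3)[OF etale_src] unit_arrow[OF x] by (auto simp: arrows_def)
  let ?W = "{\<gamma> \<in> topspace (gtop G). gsrc G \<gamma> \<in> U} \<inter> U"
  have "continuous_map (gtop G) (gtop G) (gsrc G)"
    using local_homeomorphismD(1)[OF etale_src] by (simp add: unit_space_def continuous_map_in_subtopology)
  then have "openin (gtop G) ?W"
    using U(1) by (intro openin_Int openin_continuous_map_preimage)
  moreover have "x \<in> ?W" using U(2) x by (simp add: src_of_unit topspace_gtop unit_arrow)
  moreover have "?W \<subseteq> units G"
  proof
    fix \<gamma> assume \<gamma>: "\<gamma> \<in> ?W"
    then have "\<gamma> \<in> arrows G" by (simp add: topspace_gtop)
    moreover have "gsrc G \<gamma> = \<gamma>"
      by (rule inj_onD[OF U(3)]) (use \<gamma> src_src \<open>\<gamma> \<in> arrows G\<close> in auto)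
    ultimately show "\<gamma> \<in> units G" using src_in_units by metis
  qed
  ultimately show "\<exists>T. openin (gtop G) T \<and> x \<in> T \<and> T \<subseteq> units G" by blast
qed

lemma topspace_unit_space: "topspace (unit_space G) = units G"
  using unit_arrow by (auto simp: unit_space_def topspace_gtop)

lemma Hausdorff_unit_space: "Hausdorff_space (unit_space G)"
  unfolding unit_space_def by (rule Hausdorff_space_subtopology[OF Hausdorff])

lemmas continuous_src = local_homeomorphismD(1)[OF etale_src]
  and continuous_rng = local_homeomorphismD(1)[OF etale_rng]

lemma open_invariant_openin: "open_invariant G U \<Longrightarrow> openin (gtop G) U"
  unfolding open_invariant_def unit_space_def using openin_units openin_trans_full by blast

lemma open_invariant_subset: "open_invariant G U \<Longrightarrow> U \<subseteq> units G"
  unfolding open_invariant_def using openin_subset topspace_unit_space by blast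

lemma openin_restriction:
  assumes "open_invariant G U"
  shows "openin (gtop G) (restriction G U)"
proof -
  have "restriction G U =
      {\<gamma> \<in> topspace (gtop G). grng G \<gamma> \<in> U} \<inter> {\<gamma> \<in> topspace (gtop G). gsrc G \<gamma> \<in> U}"
    by (auto simp: restriction_def topspace_gtop)
  then show ?thesis
    using assms continuous_src continuous_rng
    by (simp add: open_invariant_def openin_Int openin_continuous_map_preimage)
qed

lemma open_invariant_subset_restriction: "open_invariant G U \<Longrightarrow> U \<subseteq> restriction G U"
  using open_invariant_subset[of U]
  by (auto simp: restriction_def unit_arrow src_of_unit rng_of_unit subset_iff)

text \<open>Makes results on left spaces applicable to convolution, seen as the action of the
  groupoid on its own arrows.\<close>

lemma left_space_self: "left_space G (gtop G) (grng G) (gmult G)"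
  by (rule left_space.intro)
     (simp_all add: Hausdorff locally_compact continuous_rng local_homeomorphismD(2)[OF etale_rng]
       continuous_mult rng_mult rng_unit mult_assoc topspace_gtop)

text \<open>Inversion reverses products and exchanges range and source, so a right action becomes a
  left action with the same anchor. Both sides of the bimodule are then covered by one
  argument.\<close>

lemma left_space_inverse:
  assumes "right_space G X \<rho> act"
  shows "left_space G X \<rho> (\<lambda>\<gamma> z. act z (ginv G \<gamma>))"
proof -
  interpret R: right_space G X \<rho> act by (rule assms)
  let ?D = "{(\<gamma>, z). gsrc G \<gamma> = \<rho> z}"
  let ?P = "subtopology (prod_topology (gtop G) X) ?D"
  have fst: "continuous_map ?P (gtop G) fst" and snd: "continuous_map ?P X snd"
    by (intro continuous_map_from_subtopology continuous_map_fst continuous_map_snd)+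
  have "continuous_map ?P (gtop G) (\<lambda>w. ginv G (fst w))"
    using continuous_map_compose[OF fst continuous_inv] by (simp add: o_def)
  then have "continuous_map ?P (prod_topology X (gtop G)) (\<lambda>w. (snd w, ginv G (fst w)))"
    using snd by (simp add: continuous_map_paired)
  then have "continuous_map ?P (subtopology (prod_topology X (gtop G)) {(z, \<eta>). \<rho> z = grng G \<eta>})
      (\<lambda>w. (snd w, ginv G (fst w)))"
    by (auto simp: continuous_map_in_subtopology rng_inv topspace_gtop)
  from continuous_map_compose[OF this R.continuous_act]
  have cont: "continuous_map ?P X (\<lambda>(\<gamma>, z). act z (ginv G \<gamma>))"
    by (simp add: o_def case_prod_unfold)
  have \<rho>: "\<rho> z \<in> units G" if "z \<in> topspace X" for z
    using R.continuous_anchor that by (auto simp: continuous_map_def topspace_unit_space)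
  show ?thesis
  proof (rule left_space.intro)
    show "continuous_map ?P X (\<lambda>(\<gamma>, z). act z (ginv G \<gamma>))" by (rule cont)
  next
    fix \<gamma> z assume "\<gamma> \<in> arrows G" "z \<in> topspace X" "gsrc G \<gamma> = \<rho> z"
    then show "\<rho> (act z (ginv G \<gamma>)) = grng G \<gamma>"
      using R.anchor_act[of z "ginv G \<gamma>"] by (simp add: inv_arrow rng_inv src_inv)
  next
    fix z assume "z \<in> topspace X"
    then show "act z (ginv G (\<rho> z)) = z" by (simp add: R.act_unit inv_of_unit \<rho>)
  next
    fix \<gamma> \<eta> z
    assume "\<gamma> \<in> arrows G" "\<eta> \<in> arrows G" "z \<in> topspace X" "gsrc G \<gamma> = grng G \<eta>" "gsrc G \<eta> = \<rho> z"
    then show "act z (ginv G (gmult G \<gamma> \<eta>)) = act (act z (ginv G \<eta>)) (ginv G \<gamma>)"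
      using R.act_mult[of z "ginv G \<eta>" "ginv G \<gamma>"]
      by (simp add: inv_mult inv_arrow rng_inv src_inv)
  qed (rule R.Hausdorff R.locally_compact R.continuous_anchor R.open_anchor)+
qed

end

text \<open>
  The convolution product of \<open>C\<^sub>c(G)\<close> and both module actions on \<open>C\<^sub>c(Z)\<close> are instances of
  \<open>conv_action\<close>; for the right action of \<open>b\<close> the groupoid acts on the left by inverses and
  \<open>a \<gamma> = b (\<gamma>\<inverse>)\<close>.
\<close>

definition conv_action ::
  "'g groupoid_data \<Rightarrow> 'x topology \<Rightarrow> ('x \<Rightarrow> 'g) \<Rightarrow> ('g \<Rightarrow> 'x \<Rightarrow> 'x) \<Rightarrow>
   ('g \<Rightarrow> complex) \<Rightarrow> ('x \<Rightarrow> complex) \<Rightarrow> 'x \<Rightarrow> complex" where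
  "conv_action G X \<rho> act a \<xi> = (\<lambda>z. if z \<in> topspace X
     then \<Sum>\<^sub>\<infinity>\<gamma>\<in>{\<gamma> \<in> arrows G. grng G \<gamma> = \<rho> z}. a \<gamma> * \<xi> (act (ginv G \<gamma>) z)
     else 0)"

lemma convolution_eq_conv_action: "convolution G f g = conv_action G (gtop G) (grng G) (gmult G) f g"
  by (simp add: convolution_def conv_action_def arrows_def)

lemma Cc_left_action_eq_conv_action:
  "Cc_left_action G Z a \<xi> = conv_action G (ztop Z) (anchor_l Z) (act_l Z) a \<xi>"
  by (simp add: Cc_left_action_def conv_action_def)

text \<open>The right action evaluates its coefficient function at an inverse, and the left action
  made from it moves points by an inverse; each meets a second inversion and cancels.\<close>

lemma (in groupoid) Cc_right_action_eq_conv_action: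
  "Cc_right_action G Z \<xi> (\<lambda>\<eta>. if \<eta> \<in> arrows G then b (ginv G \<eta>) else 0) =
   conv_action G (ztop Z) (anchor_r Z) (\<lambda>\<eta> z. act_r Z z (ginv G \<eta>)) b \<xi>"
  unfolding Cc_right_action_def conv_action_def
  by (rule ext) (auto simp: inv_inv inv_arrow mult.commute intro!: infsum_cong)

text \<open>The only unit with range \<open>\<rho> z\<close> is \<open>\<rho> z\<close> itself, so a
  single term survives: functions on the unit space act as multiplication operators.\<close>

lemma (in groupoid) conv_action_units:
  assumes "\<And>\<gamma>. \<gamma> \<notin> units G \<Longrightarrow> u \<gamma> = 0" and z: "z \<in> topspace X" "\<rho> z \<in> units G" "act (\<rho> z) z = z"
  shows "conv_action G X \<rho> act u \<xi> z = u (\<rho> z) * \<xi> z"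
proof -
  have "conv_action G X \<rho> act u \<xi> z =
      (\<Sum>\<^sub>\<infinity>\<gamma>\<in>{\<gamma> \<in> arrows G. grng G \<gamma> = \<rho> z}. u \<gamma> * \<xi> (act (ginv G \<gamma>) z))"
    using z by (simp add: conv_action_def)
  also have "\<dots> = (\<Sum>\<^sub>\<infinity>\<gamma>\<in>{\<rho> z}. u \<gamma> * \<xi> (act (ginv G \<gamma>) z))"
  proof (rule infsum_cong_neutral)
    fix \<gamma> assume \<gamma>: "\<gamma> \<in> {\<gamma> \<in> arrows G. grng G \<gamma> = \<rho> z} - {\<rho> z}"
    then have "\<gamma> \<notin> units G" using rng_of_unit[of \<gamma>] by auto
    then show "u \<gamma> * \<xi> (act (ginv G \<gamma>) z) = 0" using assms(1) by simp
  qed (use z unit_arrow rng_of_unit in auto)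
  also have "\<dots> = u (\<rho> z) * \<xi> z" using z by (simp add: inv_of_unit)
  finally show ?thesis .
qed

text \<open>Continuity is that of a fibrewise sum along the range map. The result vanishes off the
  product set K L, the image of the composable pairs in K \<times> L; these form a compact set
  because equality of anchors is a closed condition. Tracking \<open>R\<close>, \<open>S\<close> and
  \<open>T\<close> yields the ideal property and the localisation of module products at the same
  time.\<close>

lemma conv_action_in_Cc:
  assumes "etale_groupoid G" and "left_space G X \<rho> act"
    and R: "openin (gtop G) R" and S: "openin X S" and T: "openin X T"
    and RST: "\<And>\<gamma> z. \<gamma> \<in> R \<Longrightarrow> z \<in> S \<Longrightarrow> gsrc G \<gamma> = \<rho> z \<Longrightarrow> act \<gamma> z \<in> T"
    and a: "a \<in> Cc (subtopology (gtop G) R)" and \<xi>: "\<xi> \<in> Cc (subtopology X S)"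
  shows "conv_action G X \<rho> act a \<xi> \<in> Cc (subtopology X T)"
proof -
  interpret etale_groupoid G by (rule assms(1))
  interpret L: left_space G X \<rho> act by (rule assms(2))
  obtain K where K: "continuous_map (gtop G) euclidean a" "compactin (gtop G) K" "K \<subseteq> R"
      "\<And>\<gamma>. \<gamma> \<notin> K \<Longrightarrow> a \<gamma> = 0"
    using a R Hausdorff by (auto simp: Cc_subtopology_iff)
  obtain L where L: "continuous_map X euclidean \<xi>" "compactin X L" "L \<subseteq> S" "\<And>z. z \<notin> L \<Longrightarrow> \<xi> z = 0"
    using \<xi> S L.Hausdorff by (auto simp: Cc_subtopology_iff)
  let ?P = "prod_topology (gtop G) X"
  let ?D = "{(\<gamma>, z). gsrc G \<gamma> = \<rho> z}"
  let ?E = "{(\<gamma>, z). grng G \<gamma> = \<rho> z}"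
  let ?Q = "subtopology ?P ?E"
  have "continuous_map ?Q (gtop G) (\<lambda>w. ginv G (fst w))"
    using continuous_map_compose[OF continuous_map_from_subtopology[OF continuous_map_fst] continuous_inv]
    by (simp add: o_def)
  then have "continuous_map ?Q ?P (\<lambda>w. (ginv G (fst w), snd w))"
    by (simp add: continuous_map_paired continuous_map_from_subtopology continuous_map_snd)
  then have "continuous_map ?Q (subtopology ?P ?D) (\<lambda>w. (ginv G (fst w), snd w))"
    by (auto simp: continuous_map_in_subtopology src_inv topspace_gtop)
  from continuous_map_compose[OF continuous_map_compose[OF this L.continuous_act] L(1)]
  have c1: "continuous_map ?Q euclidean (\<lambda>w. \<xi> (act (ginv G (fst w)) (snd w)))"
    by (simp add: o_def)
  have c2: "continuous_map ?Q euclidean (\<lambda>w. a (fst w))"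
    using continuous_map_compose[OF continuous_map_from_subtopology[OF continuous_map_fst] K(1)]
    by (simp add: o_def)
  have F: "continuous_map ?Q euclidean (\<lambda>w. a (fst w) * \<xi> (act (ginv G (fst w)) (snd w)))"
    using c1 c2 by (simp add: continuous_map_atin tendsto_mult)
  have "continuous_map X euclidean (\<lambda>z. \<Sum>\<^sub>\<infinity>\<gamma>\<in>{\<gamma> \<in> topspace (gtop G). grng G \<gamma> = \<rho> z}.
      a (fst (\<gamma>, z)) * \<xi> (act (ginv G (fst (\<gamma>, z))) (snd (\<gamma>, z))))"
    by (rule continuous_map_fibre_sum[OF Hausdorff Hausdorff_unit_space etale_rng K(2)
          L.continuous_anchor F]) (simp add: K(4))
  then have cont: "continuous_map X euclidean (conv_action G X \<rho> act a \<xi>)"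
    by (elim continuous_map_eq) (simp add: conv_action_def topspace_gtop)
  have "closedin ?P {w \<in> topspace ?P. gsrc G (fst w) = \<rho> (snd w)}"
    by (rule closedin_continuous_maps_eq[OF Hausdorff_unit_space])
       (use continuous_map_compose[OF continuous_map_fst continuous_src]
         continuous_map_compose[OF continuous_map_snd L.continuous_anchor] in \<open>simp_all add: o_def\<close>)
  moreover have "compactin ?P (K \<times> L)" using K(2) L(2) by (simp add: compactin_Times)
  ultimately have "compactin ?P ((K \<times> L) \<inter> {w \<in> topspace ?P. gsrc G (fst w) = \<rho> (snd w)})"
    by (rule compact_Int_closedin[rotated])
  moreover have KL: "(K \<times> L) \<inter> {w \<in> topspace ?P. gsrc G (fst w) = \<rho> (snd w)} = (K \<times> L) \<inter> ?D"
    using compactin_subset_topspace[OF K(2)] compactin_subset_topspace[OF L(2)] by auto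
  ultimately have "compactin (subtopology ?P ?D) ((K \<times> L) \<inter> ?D)"
    by (simp add: compactin_subtopology)
  then have C: "compactin X ((\<lambda>(\<gamma>, z). act \<gamma> z) ` ((K \<times> L) \<inter> ?D))" (is "compactin X ?C")
    using L.continuous_act by (rule image_compactin)
  have CT: "?C \<subseteq> T" using K(3) L(3) RST by auto
  have "conv_action G X \<rho> act a \<xi> z = 0" if z: "z \<notin> ?C" for z
  proof (cases "z \<in> topspace X")
    case True
    \<comment> \<open>A nonzero term would write \<open>z\<close> as \<gamma> applied to
      \<gamma>^{-1} z, with \<gamma> in \<open>K\<close> and \<gamma>^{-1} z in
      \<open>L\<close>.\<close>
    have "a \<gamma> * \<xi> (act (ginv G \<gamma>) z) = 0" if \<gamma>: "\<gamma> \<in> arrows G" "grng G \<gamma> = \<rho> z" for \<gamma>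
    proof (rule ccontr)
      assume "a \<gamma> * \<xi> (act (ginv G \<gamma>) z) \<noteq> 0"
      then have "\<gamma> \<in> K" "act (ginv G \<gamma>) z \<in> L" using K(4) L(4) by auto
      moreover have "gsrc G \<gamma> = \<rho> (act (ginv G \<gamma>) z)"
        using \<gamma> True by (simp add: L.anchor_act inv_arrow src_inv rng_inv)
      moreover have "act \<gamma> (act (ginv G \<gamma>) z) = z"
        using \<gamma> True L.act_mult[of \<gamma> "ginv G \<gamma>" z]
        by (simp add: inv_arrow src_inv rng_inv inv_right L.act_unit)
      ultimately have "z \<in> ?C" by (intro image_eqI[where x="(\<gamma>, act (ginv G \<gamma>) z)"]) auto
      then show False using z by blast
    qed
    then have "(\<Sum>\<^sub>\<infinity>\<gamma>\<in>{\<gamma> \<in> arrows G. grng G \<gamma> = \<rho> z}. a \<gamma> * \<xi> (act (ginv G \<gamma>) z)) = 0"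
      by (intro infsum_0) simp
    then show ?thesis by (simp add: conv_action_def)
  qed (simp add: conv_action_def)
  then show ?thesis
    unfolding Cc_subtopology_iff[OF L.Hausdorff T] using cont C CT by blast
qed

text \<open>The anchors of the support form a compact subset of \<open>U\<close>. A bump function
  equal to 1 there acts as multiplication by its composite with \<rho>, which leaves \<xi>
  unchanged.\<close>

lemma conv_action_left_unit:
  assumes "etale_groupoid G" and "left_space G X \<rho> act"
    and U: "openin (gtop G) U" "U \<subseteq> units G"
    and \<xi>: "\<xi> \<in> Cc (subtopology X {z \<in> topspace X. \<rho> z \<in> U})"
  obtains u where "u \<in> Cc (subtopology (gtop G) U)" "\<And>\<gamma>. cmod (u \<gamma>) \<le> 1"
    "conv_action G X \<rho> act u \<xi> = \<xi>"
proof -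
  interpret etale_groupoid G by (rule assms(1))
  interpret L: left_space G X \<rho> act by (rule assms(2))
  have \<rho>: "continuous_map X (gtop G) \<rho>"
    using L.continuous_anchor by (simp add: unit_space_def continuous_map_in_subtopology)
  have \<rho>u: "\<rho> z \<in> units G" if "z \<in> topspace X" for z
    using L.continuous_anchor that by (auto simp: continuous_map_def topspace_unit_space)
  obtain L where L: "compactin X L" "L \<subseteq> {z \<in> topspace X. \<rho> z \<in> U}" "\<And>z. z \<notin> L \<Longrightarrow> \<xi> z = 0"
    using \<xi> L.Hausdorff openin_continuous_map_preimage[OF \<rho> U(1)] by (auto simp: Cc_subtopology_iff)
  have "compactin (gtop G) (\<rho> ` L)" "\<rho> ` L \<subseteq> U"
    using L \<rho> image_compactin by auto
  then obtain u where u: "u \<in> Cc (subtopology (gtop G) U)" "\<And>x. x \<in> \<rho> ` L \<Longrightarrow> u x = 1"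
      "\<And>x. cmod (u x) \<le> 1"
    using Cc_bump[OF Hausdorff locally_compact _ U(1)] by metis
  have u0: "u \<gamma> = 0" if "\<gamma> \<notin> units G" for \<gamma>
    using u(1) that U unfolding Cc_def by auto
  have "conv_action G X \<rho> act u \<xi> z = \<xi> z" for z
  proof (cases "z \<in> topspace X")
    case True
    then have "conv_action G X \<rho> act u \<xi> z = u (\<rho> z) * \<xi> z"
      by (intro conv_action_units u0 \<rho>u L.act_unit)
    then show ?thesis using u(2) L(3) by (cases "z \<in> L") auto
  next
    case False
    then have "z \<notin> L" using L(2) by blast
    then show ?thesis using False L(3) by (simp add: conv_action_def)
  qed
  then show thesis using that u by blast
qed

section \<open>Dynamical ideals and local units in the reduced algebra\<close>

lemma subspace_image_Cc:
  assumes X: "Hausdorff_space X" and S: "openin X S" and j: "linear_on_Cc X j"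
  shows "complex_vector.subspace (j ` Cc (subtopology X S))"
proof -
  have sub: "f \<in> Cc X" if "f \<in> Cc (subtopology X S)" for f
    using that Cc_subtopology_subset_Cc[OF X S] by blast
  have Y: "Hausdorff_space (subtopology X S)" using X by (rule Hausdorff_space_subtopology)
  have scale: "c *\<^sub>C j f \<in> j ` Cc (subtopology X S)" if "f \<in> Cc (subtopology X S)" for c f
  proof -
    have "j (\<lambda>x. c * f x) = c *\<^sub>C j f" using j sub[OF that] by (simp add: linear_on_Cc_def)
    then show ?thesis using Cc_scale[OF Y that, of c] by (metis imageI)
  qed
  have "(\<lambda>_. 0) \<in> Cc (subtopology X S)" using Y by (auto simp: Cc_iff intro: exI[of _ "{}"])
  from scale[OF this, of 0] have "0 \<in> j ` Cc (subtopology X S)" by simp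
  moreover have "j f + j g \<in> j ` Cc (subtopology X S)"
    if "f \<in> Cc (subtopology X S)" "g \<in> Cc (subtopology X S)" for f g
  proof -
    have "j (\<lambda>x. f x + g x) = j f + j g" using j sub that by (simp add: linear_on_Cc_def)
    then show ?thesis using Cc_add[OF Y that] by (metis imageI)
  qed
  ultimately show ?thesis using scale by (intro complex_vector.subspaceI) auto
qed

text \<open>By invariance a product of two arrows lies in the restriction to \<open>U\<close> as
  soon as one factor does, so convolution with any function keeps supports there. Density and
  continuity of the product extend this to the completion.\<close>

lemma dyn_ideal_closed_ideal:
  fixes \<iota> :: "('g \<Rightarrow> complex) \<Rightarrow> 'a::complex_banach_algebra"
  assumes "etale_groupoid G" and \<iota>: "is_Fp_red p G \<iota>" and U: "open_invariant G U"
  shows "closed_ideal (dyn_ideal G \<iota> U)"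
proof -
  interpret etale_groupoid G by (rule assms(1))
  let ?C = "Cc (subtopology (gtop G) (restriction G U))"
  note R = openin_restriction[OF U]
  have sub: "?C \<subseteq> Cc (gtop G)" by (rule Cc_subtopology_subset_Cc[OF Hausdorff R])
  have lin: "linear_on_Cc (gtop G) \<iota>" and dense: "closure (\<iota> ` Cc (gtop G)) = UNIV"
    and hom: "\<And>f g. f \<in> Cc (gtop G) \<Longrightarrow> g \<in> Cc (gtop G) \<Longrightarrow> \<iota> (convolution G f g) = \<iota> f * \<iota> g"
    using \<iota> by (auto simp: is_Fp_red_def)
  have top: "subtopology (gtop G) (arrows G) = gtop G" "openin (gtop G) (arrows G)"
    by (simp_all add: arrows_def subtopology_topspace)
  have left: "convolution G f g \<in> ?C" if "f \<in> Cc (gtop G)" "g \<in> ?C" for f g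
    unfolding convolution_eq_conv_action
    by (rule conv_action_in_Cc[OF assms(1) left_space_self top(2) R R])
       (use that invariant_iff[OF U] in \<open>auto simp: top restriction_def mult_arrow rng_mult src_mult\<close>)
  have right: "convolution G f g \<in> ?C" if "f \<in> ?C" "g \<in> Cc (gtop G)" for f g
    unfolding convolution_eq_conv_action
    by (rule conv_action_in_Cc[OF assms(1) left_space_self R top(2) R])
       (use that invariant_iff[OF U] in \<open>auto simp: top restriction_def mult_arrow rng_mult src_mult\<close>)
  have J: "closed (dyn_ideal G \<iota> U)" "complex_vector.subspace (dyn_ideal G \<iota> U)"
    unfolding dyn_ideal_def by (simp_all add: subspace_closure subspace_image_Cc Hausdorff R lin)
  have in_J: "\<iota> f \<in> dyn_ideal G \<iota> U" if "f \<in> ?C" for f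
    unfolding dyn_ideal_def by (rule subsetD[OF closure_subset imageI[OF that]])
  have "a * x \<in> dyn_ideal G \<iota> U" if "x \<in> dyn_ideal G \<iota> U" for a x
  proof (rule bilinear_closure_mapsto[OF contractive_bilinear_mult J(1)])
    show "a \<in> closure (\<iota> ` Cc (gtop G))" by (simp add: dense)
    show "x \<in> closure (\<iota> ` ?C)" using that by (simp add: dyn_ideal_def)
    show "y * z \<in> dyn_ideal G \<iota> U" if "y \<in> \<iota> ` Cc (gtop G)" "z \<in> \<iota> ` ?C" for y z
    proof -
      obtain f g where "y = \<iota> f" "z = \<iota> g" "f \<in> Cc (gtop G)" "g \<in> ?C" using \<open>y \<in> _\<close> \<open>z \<in> _\<close> by blast
      then show ?thesis by (metis in_J left hom subsetD[OF sub])
    qed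
  qed
  moreover have "x * a \<in> dyn_ideal G \<iota> U" if "x \<in> dyn_ideal G \<iota> U" for a x
  proof (rule bilinear_closure_mapsto[OF contractive_bilinear_mult J(1)])
    show "a \<in> closure (\<iota> ` Cc (gtop G))" by (simp add: dense)
    show "x \<in> closure (\<iota> ` ?C)" using that by (simp add: dyn_ideal_def)
    show "z * y \<in> dyn_ideal G \<iota> U" if "z \<in> \<iota> ` ?C" "y \<in> \<iota> ` Cc (gtop G)" for y z
    proof -
      obtain f g where "y = \<iota> f" "z = \<iota> g" "f \<in> Cc (gtop G)" "g \<in> ?C" using \<open>y \<in> _\<close> \<open>z \<in> _\<close> by blast
      then show ?thesis by (metis in_J right hom subsetD[OF sub])
    qed
  qed
  ultimately show ?thesis using J by (simp add: closed_ideal_def)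
qed

text \<open>The operator \<lambda>_x(f) is applied to the point mass at the unit x and read off at
  x: the only \<eta> with range x and \<eta>^{-1} x = x is x itself, so this matrix entry is
  f(x).\<close>

lemma norm_Fp_red_ge:
  assumes "etale_groupoid G" and \<iota>: "is_Fp_red p G \<iota>" and p: "1 \<le> p"
    and f: "f \<in> Cc (gtop G)" and x: "x \<in> units G"
  shows "cmod (f x) \<le> norm (\<iota> f)"
proof -
  interpret etale_groupoid G by (rule assms(1))
  let ?\<delta> = "\<lambda>\<gamma>. if \<gamma> = x then 1 else 0 :: complex"
  have xS: "x \<in> src_fibre G x" using x by (simp add: src_fibre_def unit_arrow src_of_unit)
  have "regular_rep G x f ?\<delta> x =
      (\<Sum>\<^sub>\<infinity>\<eta>\<in>{\<eta> \<in> arrows G. grng G \<eta> = grng G x}. f \<eta> * ?\<delta> (gmult G (ginv G \<eta>) x))"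
    using xS by (simp add: regular_rep_def)
  also have "\<dots> = (\<Sum>\<^sub>\<infinity>\<eta>\<in>{x}. f \<eta> * ?\<delta> (gmult G (ginv G \<eta>) x))"
  proof (rule infsum_cong_neutral)
    fix \<eta> assume \<eta>: "\<eta> \<in> {\<eta> \<in> arrows G. grng G \<eta> = grng G x} - {x}"
    then have "gmult G (ginv G \<eta>) x = ginv G \<eta>"
      using src_unit[of "ginv G \<eta>"] x by (simp add: inv_arrow src_inv rng_of_unit)
    moreover have "ginv G \<eta> \<noteq> x"
      using \<eta> x inv_inv[of \<eta>] inv_of_unit[of x] by auto
    ultimately show "f \<eta> * ?\<delta> (gmult G (ginv G \<eta>) x) = 0" by simp
  qed (use x unit_arrow in auto)
  also have "\<dots> = f x"
    using x rng_unit[of x] by (simp add: inv_of_unit rng_of_unit unit_arrow)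
  finally have "ennreal (cmod (f x)) \<le> lp_norm p (src_fibre G x) (regular_rep G x f ?\<delta>)"
    using norm_le_lp_norm[OF p xS, of "regular_rep G x f ?\<delta>"] by simp
  also have "\<dots> \<le> reduced_norm p G f"
    unfolding reduced_norm_def using x lp_norm_delta[OF p xS]
    by (intro SUP_upper2[of x] SUP_upper) auto
  also have "\<dots> = ennreal (norm (\<iota> f))" using \<iota> f by (simp add: is_Fp_red_def)
  finally show ?thesis by simp
qed

text \<open>At a unit x of U outside V every function supported in the restriction to V vanishes, so
  a bump function in U with value 1 at x keeps distance at least 1 from all of them and from their
  closure.\<close>

lemma dyn_ideal_subset_iff:
  fixes \<iota> :: "('g \<Rightarrow> complex) \<Rightarrow> 'a::complex_banach_algebra"
  assumes "etale_groupoid G" and \<iota>: "is_Fp_red p G \<iota>" and p: "1 \<le> p"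
    and U: "open_invariant G U" and V: "open_invariant G V"
  shows "dyn_ideal G \<iota> U \<subseteq> dyn_ideal G \<iota> V \<longleftrightarrow> U \<subseteq> V"
proof
  interpret etale_groupoid G by (rule assms(1))
  have lin: "linear_on_Cc (gtop G) \<iota>" using \<iota> by (simp add: is_Fp_red_def)
  note CU = Cc_subtopology_subset_Cc[OF Hausdorff openin_restriction[OF U]]
  note CV = Cc_subtopology_subset_Cc[OF Hausdorff openin_restriction[OF V]]
  show "U \<subseteq> V" if sub: "dyn_ideal G \<iota> U \<subseteq> dyn_ideal G \<iota> V"
  proof (rule ccontr)
    assume "\<not> U \<subseteq> V"
    then obtain x where x: "x \<in> U" "x \<notin> V" by blast
    then have xu: "x \<in> units G" using open_invariant_subset[OF U] by blast
    have "compactin (gtop G) {x}" using unit_arrow[OF xu] by (simp add: topspace_gtop)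
    then obtain f where f: "f \<in> Cc (subtopology (gtop G) U)" "f x = 1"
      using Cc_bump[OF Hausdorff locally_compact _ open_invariant_openin[OF U], of "{x}"] x(1)
      by (metis empty_subsetI insert_subset singletonI)
    then have fU: "f \<in> Cc (subtopology (gtop G) (restriction G U))"
      using Cc_subtopology_subset[OF Hausdorff open_invariant_openin[OF U] openin_restriction[OF U]
          open_invariant_subset_restriction[OF U]] by blast
    then have "\<iota> f \<in> dyn_ideal G \<iota> U" unfolding dyn_ideal_def by (rule subsetD[OF closure_subset imageI])
    then have "\<iota> f \<in> closure (\<iota> ` Cc (subtopology (gtop G) (restriction G V)))"
      using sub by (auto simp: dyn_ideal_def)
    then obtain g where g: "g \<in> Cc (subtopology (gtop G) (restriction G V))" "dist (\<iota> g) (\<iota> f) < 1"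
      unfolding closure_approachable by (metis imageE zero_less_one)
    have fC: "f \<in> Cc (gtop G)" and gC: "g \<in> Cc (gtop G)" using fU g(1) CU CV by auto
    \<comment> \<open>Linearity on \<open>Cc\<close> is expressed by sums and scalar multiples, so
      the difference of \<open>g\<close> and \<open>f\<close> is written in that form.\<close>
    have f': "(\<lambda>x. - 1 * f x) \<in> Cc (gtop G)" by (rule Cc_scale[OF Hausdorff fC])
    have "\<iota> (\<lambda>x. g x + - 1 * f x) = \<iota> g + (- 1) *\<^sub>C \<iota> f"
      using lin gC fC f' unfolding linear_on_Cc_def by metis
    also have "(- 1) *\<^sub>C \<iota> f = - \<iota> f" by (metis complex_vector.scale_minus_left complex_vector.scale_one)
    finally have "norm (\<iota> (\<lambda>x. g x + - 1 * f x)) < 1" using g(2) by (simp add: dist_norm)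
    moreover have "cmod (g x + - 1 * f x) \<le> norm (\<iota> (\<lambda>x. g x + - 1 * f x))"
      by (rule norm_Fp_red_ge[OF assms(1) \<iota> p Cc_add[OF Hausdorff gC f'] xu])
    moreover have "g x = 0"
    proof -
      have "x \<notin> restriction G V" using x(2) xu by (simp add: restriction_def src_of_unit)
      then show ?thesis using g(1) unfolding Cc_def by simp
    qed
    ultimately show False using f(2) by simp
  qed
  show "dyn_ideal G \<iota> U \<subseteq> dyn_ideal G \<iota> V" if "U \<subseteq> V"
  proof -
    have "restriction G U \<subseteq> restriction G V" using that by (auto simp: restriction_def)
    then show ?thesis
      unfolding dyn_ideal_def using openin_restriction[OF U] openin_restriction[OF V]
      by (intro closure_mono image_mono Cc_subtopology_subset[OF Hausdorff])
  qed
qed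

text \<open>On each source fibre \<open>u\<close> acts as multiplication by u(r(\<gamma>)), which
  does not increase the modulus of any coordinate; monotonicity of the l^p norm treats all exponents
  together.\<close>

lemma norm_Fp_red_units_le:
  assumes "etale_groupoid G" and \<iota>: "is_Fp_red p G \<iota>"
    and u: "u \<in> Cc (subtopology (gtop G) (units G))" "\<And>\<gamma>. cmod (u \<gamma>) \<le> 1"
  shows "norm (\<iota> u) \<le> 1"
proof -
  interpret etale_groupoid G by (rule assms(1))
  have uC: "u \<in> Cc (gtop G)" using u(1) Cc_subtopology_subset_Cc[OF Hausdorff openin_units] by blast
  have u0: "u \<gamma> = 0" if "\<gamma> \<notin> units G" for \<gamma>
    using u(1) that unfolding Cc_def by auto
  have "cmod (regular_rep G x u \<xi> \<gamma>) \<le> cmod (\<xi> \<gamma>)" if "\<gamma> \<in> src_fibre G x" for x \<xi> \<gamma>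
  proof -
    have \<gamma>: "\<gamma> \<in> arrows G" using that by (simp add: src_fibre_def)
    have "regular_rep G x u \<xi> \<gamma> = conv_action G (gtop G) (grng G) (gmult G) u \<xi> \<gamma>"
      using that \<gamma> by (simp add: regular_rep_def conv_action_def topspace_gtop)
    also have "\<dots> = u (grng G \<gamma>) * \<xi> \<gamma>"
      using \<gamma> by (intro conv_action_units u0) (simp_all add: topspace_gtop rng_in_units rng_unit)
    finally show ?thesis
      using u(2)[of "grng G \<gamma>"] by (simp add: norm_mult mult_left_le_one_le)
  qed
  then have "lp_norm p (src_fibre G x) (regular_rep G x u \<xi>) \<le> lp_norm p (src_fibre G x) \<xi>" for x \<xi>
    by (rule lp_norm_mono)
  then have "reduced_norm p G u \<le> 1"
    unfolding reduced_norm_def by (intro SUP_least) (auto intro: order_trans)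
  moreover have "ennreal (norm (\<iota> u)) = reduced_norm p G u" using \<iota> uC by (simp add: is_Fp_red_def)
  ultimately show ?thesis by (metis ennreal_1 ennreal_le_iff zero_le_one)
qed

text \<open>Supplies \<open>approx\<close> for \<open>Ind_eqI\<close>: elements of the dense
  subalgebra have exact left units on the unit space, of norm at most 1.\<close>

lemma Fp_red_left_approximate_unit:
  fixes \<iota> :: "('g \<Rightarrow> complex) \<Rightarrow> 'a::complex_banach_algebra" and b :: 'a
  assumes "etale_groupoid G" and \<iota>: "is_Fp_red p G \<iota>"
  shows "b \<in> closure (range (\<lambda>c. c * b))"
proof (rule left_approximate_unit)
  interpret etale_groupoid G by (rule assms(1))
  show "closure (\<iota> ` Cc (gtop G)) = UNIV" using \<iota> by (simp add: is_Fp_red_def)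
  fix d assume "d \<in> \<iota> ` Cc (gtop G)"
  then obtain f where f: "f \<in> Cc (gtop G)" "d = \<iota> f" by blast
  have "{z \<in> topspace (gtop G). grng G z \<in> units G} = topspace (gtop G)"
    using rng_in_units by (auto simp: topspace_gtop)
  then have "f \<in> Cc (subtopology (gtop G) {z \<in> topspace (gtop G). grng G z \<in> units G})"
    using f(1) by (simp add: subtopology_topspace)
  then obtain u where u: "u \<in> Cc (subtopology (gtop G) (units G))" "\<And>\<gamma>. cmod (u \<gamma>) \<le> 1"
      "conv_action G (gtop G) (grng G) (gmult G) u f = f"
    using conv_action_left_unit[OF assms(1) left_space_self openin_units subset_refl] by metis
  have uC: "u \<in> Cc (gtop G)" using u(1) Cc_subtopology_subset_Cc[OF Hausdorff openin_units] by blast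
  have "\<iota> u * \<iota> f = \<iota> (convolution G u f)" using \<iota> uC f(1) by (simp add: is_Fp_red_def)
  then have "\<iota> u * d = d" using u(3) f(2) by (simp add: convolution_eq_conv_action)
  then show "\<exists>u. norm u \<le> 1 \<and> u * d = d" using norm_Fp_red_units_le[OF assms u(1,2)] by blast
qed

text \<open>One inclusion is localisation of supports; for the other, a local unit exhibits each
  \<xi> supported over \<open>U\<close> as a product u \<xi>. The maps \<open>m\<close> and
  \<open>\<iota>\<close> stay abstract so that the right action, with its arguments swapped and with
  \<open>\<iota>\<close> precomposed with inversion, is an instance too.\<close>

lemma closed_span_conv_action:
  fixes m :: "'a::complex_banach \<Rightarrow> 'f::complex_banach \<Rightarrow> 'f"
  assumes "etale_groupoid G" and "left_space G X \<rho> act" and U: "open_invariant G U"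
    and m: "contractive_bilinear m" and j: "linear_on_Cc X j" "closure (j ` Cc X) = UNIV"
    and mj: "\<And>a \<xi>. a \<in> Cc (gtop G) \<Longrightarrow> \<xi> \<in> Cc X \<Longrightarrow> m (\<iota> a) (j \<xi>) = j (conv_action G X \<rho> act a \<xi>)"
  shows "closed_span {m a f | a f. a \<in> closure (\<iota> ` Cc (subtopology (gtop G) (restriction G U)))}
    = closure (j ` Cc (subtopology X {z \<in> topspace X. \<rho> z \<in> U}))"
    (is "closed_span ?M = closure (j ` ?C)")
proof
  interpret etale_groupoid G by (rule assms(1))
  interpret L: left_space G X \<rho> act by (rule assms(2))
  let ?X = "{z \<in> topspace X. \<rho> z \<in> U}" and ?R = "Cc (subtopology (gtop G) (restriction G U))"
  have X: "openin X ?X"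
    using L.continuous_anchor U openin_continuous_map_preimage unfolding open_invariant_def by blast
  note R = openin_restriction[OF U]
  have subR: "?R \<subseteq> Cc (gtop G)" by (rule Cc_subtopology_subset_Cc[OF Hausdorff R])
  have subX: "?C \<subseteq> Cc X" by (rule Cc_subtopology_subset_Cc[OF L.Hausdorff X])
  have act: "act \<gamma> z \<in> ?X" if "\<gamma> \<in> restriction G U" "z \<in> topspace X" "gsrc G \<gamma> = \<rho> z" for \<gamma> z
  proof -
    have \<gamma>: "\<gamma> \<in> topspace (gtop G)" using that by (simp add: restriction_def topspace_gtop)
    have "act \<gamma> z \<in> topspace X"
      using funcset_mem[OF continuous_map_funspace[OF L.continuous_act], of "(\<gamma>, z)"] \<gamma> that by simp
    then show ?thesis using that by (simp add: restriction_def L.anchor_act)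
  qed
  have "m (\<iota> a) (j \<xi>) \<in> j ` ?C" if "a \<in> ?R" "\<xi> \<in> Cc X" for a \<xi>
  proof -
    have "conv_action G X \<rho> act a \<xi> \<in> ?C"
      by (rule conv_action_in_Cc[OF assms(1,2) R openin_topspace X act])
         (use that in \<open>simp_all add: subtopology_topspace\<close>)
    then show ?thesis using mj that subR by auto
  qed
  then have "m x y \<in> j ` ?C" if "x \<in> \<iota> ` ?R" "y \<in> j ` Cc X" for x y
    using that by blast
  then have mem: "m x y \<in> closure (j ` ?C)" if "x \<in> \<iota> ` ?R" "y \<in> j ` Cc X" for x y
    by (rule subsetD[OF closure_subset]) (use that in blast)+
  have "m a f \<in> closure (j ` ?C)" if "a \<in> closure (\<iota> ` ?R)" for a f
    by (rule bilinear_closure_mapsto[where S="\<iota> ` ?R" and T="j ` Cc X", OF m closed_closure mem that])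
       (unfold j(2), simp_all)
  then show "closed_span ?M \<subseteq> closure (j ` ?C)"
    by (intro closed_span_least subspace_closure subspace_image_Cc L.Hausdorff X j(1)) auto
  have "j ` ?C \<subseteq> closed_span ?M"
  proof (rule image_subsetI, rule closed_span_base)
    fix \<xi> assume \<xi>: "\<xi> \<in> ?C"
    obtain u where u: "u \<in> Cc (subtopology (gtop G) U)" "conv_action G X \<rho> act u \<xi> = \<xi>"
      using conv_action_left_unit[OF assms(1,2) open_invariant_openin[OF U]
          open_invariant_subset[OF U] \<xi>] by metis
    have uR: "u \<in> ?R"
      using u(1) Cc_subtopology_subset[OF Hausdorff open_invariant_openin[OF U] R
          open_invariant_subset_restriction[OF U]] by blast
    then have "j \<xi> = m (\<iota> u) (j \<xi>)" using mj[OF subsetD[OF subR uR] subsetD[OF subX \<xi>]] u(2) by simp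
    moreover have "\<iota> u \<in> closure (\<iota> ` ?R)" by (rule subsetD[OF closure_subset imageI[OF uR]])
    ultimately show "j \<xi> \<in> ?M" by blast
  qed
  then show "closure (j ` ?C) \<subseteq> closed_span ?M"
    by (intro closure_minimal closed_closed_span)
qed

text \<open>Inversion is continuous and exchanges range and source, so it maps compact subsets of
  the restriction to compact subsets of it.\<close>

lemma (in etale_groupoid) Cc_restriction_inverse:
  assumes U: "open_invariant G U" and b: "b \<in> Cc (subtopology (gtop G) (restriction G U))"
  shows "(\<lambda>\<gamma>. if \<gamma> \<in> arrows G then b (ginv G \<gamma>) else 0) \<in> Cc (subtopology (gtop G) (restriction G U))"
    (is "?b \<in> _")
proof -
  note R = openin_restriction[OF U]
  obtain K where K: "continuous_map (gtop G) euclidean b" "compactin (gtop G) K"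
      "K \<subseteq> restriction G U" "\<And>\<gamma>. \<gamma> \<notin> K \<Longrightarrow> b \<gamma> = 0"
    using b unfolding Cc_subtopology_iff[OF Hausdorff R] by blast
  have "continuous_map (gtop G) euclidean (\<lambda>\<gamma>. b (ginv G \<gamma>))"
    using continuous_map_compose[OF continuous_inv K(1)] by (simp add: o_def)
  then have "continuous_map (gtop G) euclidean ?b"
    by (elim continuous_map_eq) (simp add: topspace_gtop)
  moreover have "compactin (gtop G) (ginv G ` K)"
    using K(2) continuous_inv by (rule image_compactin)
  moreover have "ginv G ` K \<subseteq> restriction G U"
    using K(3) by (auto simp: restriction_def inv_arrow src_inv rng_inv)
  moreover have "?b \<gamma> = 0" if "\<gamma> \<notin> ginv G ` K" for \<gamma>
  proof (cases "\<gamma> \<in> arrows G")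
    case True
    then have "ginv G \<gamma> \<notin> K" using that inv_inv by (metis imageI)
    then show ?thesis using K(4) by simp
  qed simp
  ultimately show ?thesis unfolding Cc_subtopology_iff[OF Hausdorff R] by blast
qed

section \<open>Groupoid equivalences\<close>

lemma topspace_quotient_topology: "topspace (quotient_topology X q) = q ` topspace X"
proof
  show "topspace (quotient_topology X q) \<subseteq> q ` topspace X"
    using openin_topspace openin_quotient_topology by metis
  have "{x \<in> topspace X. q x \<in> q ` topspace X} = topspace X" by blast
  then show "q ` topspace X \<subseteq> topspace (quotient_topology X q)"
    by (intro openin_subset) (simp add: openin_quotient_topology)
qed

context groupoid_equivalence
begin

lemma anchor_l_unit: "z \<in> topspace (ztop Z) \<Longrightarrow> anchor_l Z z \<in> topspace (unit_space G)"
  using free_proper_left_space.axioms(1)[OF left] left_space.continuous_anchor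
  by (fastforce simp: continuous_map_def)

lemma anchor_r_unit: "z \<in> topspace (ztop Z) \<Longrightarrow> anchor_r Z z \<in> topspace (unit_space H)"
  using free_proper_right_space.axioms(1)[OF right] right_space.continuous_anchor
  by (fastforce simp: continuous_map_def)

lemma anchor_l_surj: "anchor_l Z ` topspace (ztop Z) = topspace (unit_space G)"
proof -
  obtain h where h: "homeomorphic_map (quotient_topology (ztop Z) (orbit_r H Z)) (unit_space G) h"
    "\<forall>z\<in>topspace (ztop Z). h (orbit_r H Z z) = anchor_l Z z"
    using anchor_l_induces_homeomorphism by blast
  have "h ` orbit_r H Z ` topspace (ztop Z) = topspace (unit_space G)"
    using homeomorphic_imp_surjective_map[OF h(1)] by (simp add: topspace_quotient_topology)
  then show ?thesis using h(2) by (simp add: image_image)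
qed

lemma anchor_r_surj: "anchor_r Z ` topspace (ztop Z) = topspace (unit_space H)"
proof -
  obtain h where h: "homeomorphic_map (quotient_topology (ztop Z) (orbit_l G Z)) (unit_space H) h"
    "\<forall>z\<in>topspace (ztop Z). h (orbit_l G Z z) = anchor_r Z z"
    using anchor_r_induces_homeomorphism by blast
  have "h ` orbit_l G Z ` topspace (ztop Z) = topspace (unit_space H)"
    using homeomorphic_imp_surjective_map[OF h(1)] by (simp add: topspace_quotient_topology)
  then show ?thesis using h(2) by (simp add: image_image)
qed

text \<open>The map induced on orbits is injective, so equal anchors mean equal orbits, and
  \<open>z\<close> belongs to its own orbit through a unit.\<close>

lemma anchor_r_eqD:
  assumes "etale_groupoid G" "z \<in> topspace (ztop Z)" "w \<in> topspace (ztop Z)"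
    "anchor_r Z z = anchor_r Z w"
  obtains \<gamma> where "\<gamma> \<in> arrows G" "gsrc G \<gamma> = anchor_l Z w" "z = act_l Z \<gamma> w"
proof -
  interpret etale_groupoid G by (rule assms(1))
  interpret L: free_proper_left_space G "ztop Z" "anchor_l Z" "act_l Z" by (rule left)
  obtain h where h: "homeomorphic_map (quotient_topology (ztop Z) (orbit_l G Z)) (unit_space H) h"
    "\<forall>z\<in>topspace (ztop Z). h (orbit_l G Z z) = anchor_r Z z"
    using anchor_r_induces_homeomorphism by blast
  have "orbit_l G Z z = orbit_l G Z w"
    by (rule inj_onD[OF homeomorphic_imp_injective_map[OF h(1)]])
       (use assms h(2) in \<open>auto simp: topspace_quotient_topology\<close>)
  moreover have "anchor_l Z z \<in> units G"
    using anchor_l_unit[OF assms(2)] by (simp add: topspace_unit_space)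
  then have "z \<in> orbit_l G Z z"
    unfolding orbit_l_def using L.act_unit[OF assms(2)] unit_arrow src_of_unit
    by (intro CollectI exI[of _ "anchor_l Z z"]) simp
  ultimately have "z \<in> orbit_l G Z w" by simp
  then show thesis using that unfolding orbit_l_def by blast
qed

lemma anchor_l_eqD:
  assumes "etale_groupoid H" "z \<in> topspace (ztop Z)" "w \<in> topspace (ztop Z)"
    "anchor_l Z z = anchor_l Z w"
  obtains \<eta> where "\<eta> \<in> arrows H" "anchor_r Z w = grng H \<eta>" "z = act_r Z w \<eta>"
proof -
  interpret etale_groupoid H by (rule assms(1))
  interpret R: free_proper_right_space H "ztop Z" "anchor_r Z" "act_r Z" by (rule right)
  obtain h where h: "homeomorphic_map (quotient_topology (ztop Z) (orbit_r H Z)) (unit_space G) h"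
    "\<forall>z\<in>topspace (ztop Z). h (orbit_r H Z z) = anchor_l Z z"
    using anchor_l_induces_homeomorphism by blast
  have "orbit_r H Z z = orbit_r H Z w"
    by (rule inj_onD[OF homeomorphic_imp_injective_map[OF h(1)]])
       (use assms h(2) in \<open>auto simp: topspace_quotient_topology\<close>)
  moreover have "anchor_r Z z \<in> units H"
    using anchor_r_unit[OF assms(2)] by (simp add: topspace_unit_space)
  then have "z \<in> orbit_r H Z z"
    unfolding orbit_r_def using R.act_unit[OF assms(2)] unit_arrow rng_of_unit
    by (intro CollectI exI[of _ "anchor_r Z z"]) simp
  ultimately have "z \<in> orbit_r H Z w" by simp
  then show thesis using that unfolding orbit_r_def by blast
qed

text \<open>A representative \<open>w\<close> of the same right anchor differs from \<open>z\<close>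
  by an arrow \<gamma> of G, which moves the left anchor from s(\<gamma>) to r(\<gamma>); invariance
  of \<open>U\<close> makes the choice of \<open>w\<close> irrelevant.\<close>

lemma anchor_r_in_Theta_iff:
  assumes "etale_groupoid G" and U: "open_invariant G U" and z: "z \<in> topspace (ztop Z)"
  shows "anchor_r Z z \<in> Theta Z U \<longleftrightarrow> anchor_l Z z \<in> U"
proof
  interpret etale_groupoid G by (rule assms(1))
  interpret L: free_proper_left_space G "ztop Z" "anchor_l Z" "act_l Z" by (rule left)
  assume "anchor_r Z z \<in> Theta Z U"
  then obtain w where w: "w \<in> topspace (ztop Z)" "anchor_l Z w \<in> U" "anchor_r Z z = anchor_r Z w"
    by (auto simp: Theta_def)
  then obtain \<gamma> where \<gamma>: "\<gamma> \<in> arrows G" "gsrc G \<gamma> = anchor_l Z w" "z = act_l Z \<gamma> w"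
    using anchor_r_eqD[OF assms(1) z] by metis
  then show "anchor_l Z z \<in> U"
    using w L.anchor_act[of \<gamma> w] invariant_iff[OF U \<gamma>(1)] by simp
qed (use z in \<open>auto simp: Theta_def\<close>)

text \<open>Openness comes from the open right anchor map. Acting by \<eta> moves the right anchor
  from r(\<eta>) to s(\<eta>) and fixes the left anchor, so the same condition on \<open>U\<close>
  persists.\<close>

lemma open_invariant_Theta:
  assumes "etale_groupoid G" and "etale_groupoid H" and U: "open_invariant G U"
  shows "open_invariant H (Theta Z U)"
  unfolding open_invariant_def
proof (intro conjI ballI impI)
  interpret H: etale_groupoid H by (rule assms(2))
  interpret L: free_proper_left_space G "ztop Z" "anchor_l Z" "act_l Z" by (rule left)
  interpret R: free_proper_right_space H "ztop Z" "anchor_r Z" "act_r Z" by (rule right)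
  have "openin (ztop Z) {z \<in> topspace (ztop Z). anchor_l Z z \<in> U}"
    using L.continuous_anchor U openin_continuous_map_preimage unfolding open_invariant_def by blast
  then show "openin (unit_space H) (Theta Z U)"
    using R.open_anchor by (simp add: Theta_def open_map_def)
  fix \<eta> assume \<eta>: "\<eta> \<in> arrows H" "grng H \<eta> \<in> Theta Z U"
  then obtain z where z: "z \<in> topspace (ztop Z)" "anchor_l Z z \<in> U" "grng H \<eta> = anchor_r Z z"
    by (auto simp: Theta_def)
  have "act_r Z z \<eta> \<in> topspace (ztop Z)"
    using funcset_mem[OF continuous_map_funspace[OF R.continuous_act], of "(z, \<eta>)"] z \<eta>(1)
    by (simp add: topspace_gtop)
  moreover have "anchor_l Z (act_r Z z \<eta>) \<in> U" using z \<eta>(1) by (simp add: anchor_l_act_r)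
  moreover have "anchor_r Z (act_r Z z \<eta>) = gsrc H \<eta>" using z \<eta>(1) by (simp add: R.anchor_act)
  ultimately show "gsrc H \<eta> \<in> Theta Z U" by (force simp: Theta_def)
qed

lemma Theta_surj:
  assumes "etale_groupoid G" and "etale_groupoid H" and V: "open_invariant H V"
  obtains U where "open_invariant G U" "Theta Z U = V"
proof -
  interpret G: etale_groupoid G by (rule assms(1))
  interpret H: etale_groupoid H by (rule assms(2))
  interpret L: free_proper_left_space G "ztop Z" "anchor_l Z" "act_l Z" by (rule left)
  interpret R: free_proper_right_space H "ztop Z" "anchor_r Z" "act_r Z" by (rule right)
  let ?W = "{z \<in> topspace (ztop Z). anchor_r Z z \<in> V}"
  \<comment> \<open>The mirror image of \<open>Theta\<close>, with the two anchors
    exchanged.\<close>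
  let ?U = "anchor_l Z ` ?W"
  have "openin (ztop Z) ?W"
    using R.continuous_anchor V openin_continuous_map_preimage unfolding open_invariant_def by blast
  then have "openin (unit_space G) ?U" using L.open_anchor by (simp add: open_map_def)
  moreover have "gsrc G \<gamma> \<in> ?U" if \<gamma>: "\<gamma> \<in> arrows G" "grng G \<gamma> \<in> ?U" for \<gamma>
  proof -
    obtain z where z: "z \<in> topspace (ztop Z)" "anchor_r Z z \<in> V" "grng G \<gamma> = anchor_l Z z"
      using \<gamma> by auto
    have i: "ginv G \<gamma> \<in> arrows G" "gsrc G (ginv G \<gamma>) = anchor_l Z z"
      using \<gamma>(1) z(3) by (simp_all add: G.inv_arrow G.src_inv)
    have "act_l Z (ginv G \<gamma>) z \<in> topspace (ztop Z)"
      using funcset_mem[OF continuous_map_funspace[OF L.continuous_act], of "(ginv G \<gamma>, z)"] z i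
      by (simp add: topspace_gtop)
    moreover have "anchor_r Z (act_l Z (ginv G \<gamma>) z) \<in> V" using z i by (simp add: anchor_r_act_l)
    moreover have "anchor_l Z (act_l Z (ginv G \<gamma>) z) = gsrc G \<gamma>"
      using z i \<gamma>(1) by (simp add: L.anchor_act G.rng_inv)
    ultimately show ?thesis by force
  qed
  ultimately have U: "open_invariant G ?U" by (simp add: open_invariant_def)
  \<comment> \<open>\<open>?W\<close> is a union of fibres of the left anchor: such a fibre is a
    single H-orbit, and \<open>V\<close> is invariant.\<close>
  have "{z \<in> topspace (ztop Z). anchor_l Z z \<in> ?U} = ?W"
  proof
    show "{z \<in> topspace (ztop Z). anchor_l Z z \<in> ?U} \<subseteq> ?W"
    proof clarify
      fix z w assume z: "z \<in> topspace (ztop Z)" and w: "w \<in> topspace (ztop Z)" "anchor_r Z w \<in> V"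
        and eq: "anchor_l Z z = anchor_l Z w"
      obtain \<eta> where \<eta>: "\<eta> \<in> arrows H" "anchor_r Z w = grng H \<eta>" "z = act_r Z w \<eta>"
        using anchor_l_eqD[OF assms(2) z w(1) eq] by metis
      then show "anchor_r Z z \<in> V"
        using z w R.anchor_act[OF w(1) \<eta>(1,2)] H.invariant_iff[OF V \<eta>(1)] by simp
    qed
  qed blast
  then have "Theta Z ?U = anchor_r Z ` ?W" by (simp add: Theta_def)
  also have "\<dots> = V"
  proof -
    have "V \<subseteq> anchor_r Z ` topspace (ztop Z)"
      using V openin_subset unfolding anchor_r_surj open_invariant_def by blast
    then show ?thesis by blast
  qed
  finally show thesis using that U by blast
qed

lemma Theta_subset_iff:
  assumes "etale_groupoid G" and U: "open_invariant G U" and V: "open_invariant G V"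
  shows "Theta Z U \<subseteq> Theta Z V \<longleftrightarrow> U \<subseteq> V"
proof
  assume sub: "Theta Z U \<subseteq> Theta Z V"
  show "U \<subseteq> V"
  proof
    fix x assume x: "x \<in> U"
    then have "x \<in> topspace (unit_space G)"
      using U openin_subset unfolding open_invariant_def by blast
    then obtain z where z: "z \<in> topspace (ztop Z)" "x = anchor_l Z z"
      using anchor_l_surj by blast
    then have "anchor_r Z z \<in> Theta Z U" using x by (simp add: anchor_r_in_Theta_iff[OF assms(1) U])
    then show "x \<in> V" using sub z anchor_r_in_Theta_iff[OF assms(1) V z(1)] by blast
  qed
qed (auto simp: Theta_def)

lemma Theta_Un: "Theta Z (U \<union> V) = Theta Z U \<union> Theta Z V"
  by (auto simp: Theta_def)

lemma Theta_Int:
  assumes "etale_groupoid G" and U: "open_invariant G U" and V: "open_invariant G V"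
  shows "Theta Z (U \<inter> V) = Theta Z U \<inter> Theta Z V"
proof
  show "Theta Z U \<inter> Theta Z V \<subseteq> Theta Z (U \<inter> V)"
  proof
    fix y assume y: "y \<in> Theta Z U \<inter> Theta Z V"
    then obtain z where z: "z \<in> topspace (ztop Z)" "anchor_l Z z \<in> U" "y = anchor_r Z z"
      by (auto simp: Theta_def)
    \<comment> \<open>The witness found for \<open>U\<close> serves for \<open>V\<close> as well,
      since membership does not depend on the representative.\<close>
    then have "anchor_l Z z \<in> V" using y anchor_r_in_Theta_iff[OF assms(1) V z(1)] by simp
    then show "y \<in> Theta Z (U \<inter> V)" using z by (auto simp: Theta_def)
  qed
qed (auto simp: Theta_def)

end

section \<open>Induction of dynamical ideals and the lattice isomorphism\<close>

lemma dynamical_ideals_eq: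
  assumes "etale_groupoid G" and "is_Fp_red p G \<iota>"
  shows "dynamical_ideals G \<iota> = dyn_ideal G \<iota> ` {U. open_invariant G U}"
  using dyn_ideal_closed_ideal[OF assms] by (auto simp: dynamical_ideals_def)

lemma Ind_dyn_ideal:
  assumes "etale_groupoid G" and "etale_groupoid H" and "groupoid_equivalence G H Z"
    and \<iota>G: "is_Fp_red p G \<iota>G" and \<iota>H: "is_Fp_red p H \<iota>H"
    and M: "standard_morita G H Z \<iota>G \<iota>H j M" and U: "open_invariant G U"
  shows "Ind M (dyn_ideal G \<iota>G U) = dyn_ideal H \<iota>H (Theta Z U)"
proof -
  interpret G: etale_groupoid G by (rule assms(1))
  interpret H: etale_groupoid H by (rule assms(2))
  interpret Z: groupoid_equivalence G H Z by (rule assms(3))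
  interpret L: free_proper_left_space G "ztop Z" "anchor_l Z" "act_l Z" by (rule Z.left)
  interpret R: free_proper_right_space H "ztop Z" "anchor_r Z" "act_r Z" by (rule Z.right)
  have ME: "morita_equivalence M" and j: "linear_on_Cc (ztop Z) j" "closure (j ` Cc (ztop Z)) = UNIV"
    and left: "\<And>a \<xi>. a \<in> Cc (gtop G) \<Longrightarrow> \<xi> \<in> Cc (ztop Z) \<Longrightarrow>
        gt_left M (\<iota>G a) (j \<xi>) = j (Cc_left_action G Z a \<xi>)"
    and right: "\<And>\<xi> b. \<xi> \<in> Cc (ztop Z) \<Longrightarrow> b \<in> Cc (gtop H) \<Longrightarrow>
        gt_right M (j \<xi>) (\<iota>H b) = j (Cc_right_action H Z \<xi> b)"
    using M by (auto simp: standard_morita_def)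
  have bl: "contractive_bilinear (gt_left M)" "contractive_bilinear (gt_right M)"
    using morita_equivalence.bimodule_gt[OF ME] by (auto simp: banach_bimodule_def)
  then have bl': "contractive_bilinear (\<lambda>b f. gt_right M f b)"
    by (simp add: contractive_bilinear_def mult.commute)
  let ?V = "Theta Z U" and ?flip = "\<lambda>b \<eta>. if \<eta> \<in> arrows H then b (ginv H \<eta>) else (0::complex)"
  let ?CH = "Cc (subtopology (gtop H) (restriction H ?V))"
  have V: "open_invariant H ?V" by (rule Z.open_invariant_Theta[OF assms(1,2) U])
  \<comment> \<open>The restriction to the invariant set of all units is the whole groupoid, so this
    is a case of the result for restrictions.\<close>
  have flip_Cc: "?flip b \<in> Cc (gtop H)" if "b \<in> Cc (gtop H)" for b
  proof -
    have "open_invariant H (units H)"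
      using openin_topspace[of "unit_space H"] H.src_in_units
      by (simp add: open_invariant_def H.topspace_unit_space)
    moreover have "restriction H (units H) = topspace (gtop H)"
      by (auto simp: restriction_def topspace_gtop H.src_in_units H.rng_in_units)
    ultimately show ?thesis
      using H.Cc_restriction_inverse[of "units H" b] that by (simp add: subtopology_topspace)
  qed
  have flip_flip: "?flip (?flip b) = b" if "b \<in> Cc (gtop H)" for b
    using that by (auto simp: Cc_def topspace_gtop H.inv_arrow H.inv_inv)
  have "closed_span {gt_left M a f | a f. a \<in> dyn_ideal G \<iota>G U} =
      closure (j ` Cc (subtopology (ztop Z) {z \<in> topspace (ztop Z). anchor_l Z z \<in> U}))"
    unfolding dyn_ideal_def
    by (rule closed_span_conv_action[OF assms(1) L.left_space_axioms U bl(1) j])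
       (simp add: left Cc_left_action_eq_conv_action)
  moreover have "{z \<in> topspace (ztop Z). anchor_l Z z \<in> U} =
      {z \<in> topspace (ztop Z). anchor_r Z z \<in> ?V}"
    using Z.anchor_r_in_Theta_iff[OF assms(1) U] by blast
  moreover have "closed_span {gt_right M f b | b f. b \<in> closure ((\<lambda>b. \<iota>H (?flip b)) ` ?CH)} =
      closure (j ` Cc (subtopology (ztop Z) {z \<in> topspace (ztop Z). anchor_r Z z \<in> ?V}))"
    by (rule closed_span_conv_action[OF assms(2) H.left_space_inverse[OF R.right_space_axioms] V bl' j])
       (simp add: right flip_Cc H.Cc_right_action_eq_conv_action)
  \<comment> \<open>Inversion is an involution of \<open>?CH\<close>; precomposing with it changes
    single values but not the image, hence not the dynamical ideal.\<close>
  moreover have "(\<lambda>b. \<iota>H (?flip b)) ` ?CH = \<iota>H ` ?CH"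
  proof -
    have flip: "?flip b \<in> ?CH" if "b \<in> ?CH" for b
      by (rule H.Cc_restriction_inverse[OF V that])
    have "b \<in> ?flip ` ?CH" if "b \<in> ?CH" for b
    proof (rule image_eqI[OF _ flip[OF that]])
      have "b \<in> Cc (gtop H)"
        using that Cc_subtopology_subset_Cc[OF H.Hausdorff H.openin_restriction[OF V]] by blast
      then show "b = ?flip (?flip b)" by (simp only: flip_flip)
    qed
    then have "?flip ` ?CH = ?CH" using flip by (intro equalityI image_subsetI subsetI)
    then show ?thesis by (metis image_image)
  qed
  ultimately have "closed_span {gt_left M a f | a f. a \<in> dyn_ideal G \<iota>G U} =
      closed_span {gt_right M f b | b f. b \<in> dyn_ideal H \<iota>H ?V}"
    by (simp add: dyn_ideal_def)
  moreover have "{gt_right M f b | b f. b \<in> dyn_ideal H \<iota>H ?V} =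
      {gt_right M f b | f b. b \<in> dyn_ideal H \<iota>H ?V}" by blast
  ultimately show ?thesis
    by (intro Ind_eqI[OF ME dyn_ideal_closed_ideal[OF assms(1) \<iota>G U]
          dyn_ideal_closed_ideal[OF assms(2) \<iota>H V]] Fp_red_left_approximate_unit[OF assms(2) \<iota>H]) simp
qed

theorem corollary5p5:
  fixes G :: "'g groupoid_data" and H :: "'h groupoid_data"
    and Z :: "('g, 'h, 'z) bispace" and p :: ennreal
    and \<iota>G :: "('g \<Rightarrow> complex) \<Rightarrow> 'a::complex_banach_algebra"
    and \<iota>H :: "('h \<Rightarrow> complex) \<Rightarrow> 'b::complex_banach_algebra"
    and j :: "('z \<Rightarrow> complex) \<Rightarrow> 'f::complex_banach"
    and M :: "('a, 'b, 'e::complex_banach, 'f) morita_data"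
  assumes "etale_groupoid G" and "paracompact_space (unit_space G)"
    and "etale_groupoid H" and "paracompact_space (unit_space H)"
    and "groupoid_equivalence G H Z"
    and "1 \<le> p"
    and "is_Fp_red p G \<iota>G" and "is_Fp_red p H \<iota>H"
    and "standard_morita G H Z \<iota>G \<iota>H j M"
  shows "lattice_isomorphism (inclusion_order (dynamical_ideals G \<iota>G))
           (inclusion_order (dynamical_ideals H \<iota>H)) (Ind M) \<and>
         (\<forall>U. open_invariant G U \<longrightarrow> Ind M (dyn_ideal G \<iota>G U) = dyn_ideal H \<iota>H (Theta Z U))"
proof (intro conjI allI impI)
  interpret Z: groupoid_equivalence G H Z by (rule assms(5))
  note G = assms(1) and H = assms(3)
  show Ind: "Ind M (dyn_ideal G \<iota>G U) = dyn_ideal H \<iota>H (Theta Z U)" if "open_invariant G U" for U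
    using Ind_dyn_ideal[OF G H assms(5,7,8,9) that] .
  have bij: "bij_betw (Theta Z) {U. open_invariant G U} {V. open_invariant H V}"
  proof (rule bij_betw_imageI)
    show "inj_on (Theta Z) {U. open_invariant G U}"
    proof (rule inj_onI)
      fix U V assume "U \<in> {U. open_invariant G U}" "V \<in> {U. open_invariant G U}" "Theta Z U = Theta Z V"
      then show "U = V"
        using Z.Theta_subset_iff[OF G, of U V] Z.Theta_subset_iff[OF G, of V U] by auto
    qed
    show "Theta Z ` {U. open_invariant G U} = {V. open_invariant H V}"
      using Z.open_invariant_Theta[OF G H] Z.Theta_surj[OF G H] by blast
  qed
  show "lattice_isomorphism (inclusion_order (dynamical_ideals G \<iota>G))
           (inclusion_order (dynamical_ideals H \<iota>H)) (Ind M)"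
    \<comment> \<open>Both carriers become images of the families of open invariant sets, which
      serve as the labels.\<close>
    unfolding dynamical_ideals_eq[OF G assms(7)] dynamical_ideals_eq[OF H assms(8)]
    by (rule lattice_isomorphism_images[OF _ _ _ _ _ _ bij])
       (simp_all add: dyn_ideal_subset_iff[OF G assms(7,6)] dyn_ideal_subset_iff[OF H assms(8,6)]
         open_invariant_Un open_invariant_Int Z.Theta_Un Z.Theta_Int[OF G] Ind)
qed

end
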